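(* Literals can be universally quantified from a Decision-DNNF circuit in time linear in the circuit size while yielding an NNF circuit. That is, there is an algorithm that, given a Decision-DNNF circuit $\Delta$ and a set of literals $\{\ell_1,\ldots,\ell_n\}$, outputs in time linear in the size of $\Delta$ an NNF circuit that is logically equivalent to $\forall \ell_1,\ldots,\ell_n\cdot\Delta$.
   Context: An NNF circuit is a Boolean circuit (rooted directed acyclic graph) whose leaves are labelled with constants true/false or literals ($x$ or $\bar{x}$ for a Boolean variable $X$) and whose internal nodes are and-nodes or or-nodes; its size is the size of this graph. An NNF circuit is decomposable if for every and-node the sets of variables of its children $\alpha_1,\ldots,\alpha_k$ are pairwise disjoint. A Decision-DNNF circuit is a decomposable NNF circuit in which every or-node has the form $(\ell\wedge\alpha)\vee(\bar{\ell}\wedge\beta)$ for some literal $\ell$. Conditioning: $\varphi|x$ (resp. $\varphi|\bar{x}$) is obtained by replacing every occurrence of variable $X$ in $\varphi$ with true (resp. false). Universal literal quantification is $\forall \ell\cdot\varphi = (\ell\vee(\varphi|\bar{\ell}))\wedge(\varphi|\ell)$ (with $\bar{\ell}$ the complement of $\ell$); several literals are quantified successively (the order does not matter up to logical equivalence). *)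

theory Defs
  imports Main
begin

section \<open>Boolean formulas, conditioning and literal quantification\<close>

datatype lit = Pos nat | Neg nat

fun lit_var :: "lit \<Rightarrow> nat" where
  "lit_var (Pos x) = x"
| "lit_var (Neg x) = x"

fun compl :: "lit \<Rightarrow> lit" where
  "compl (Pos x) = Neg x"
| "compl (Neg x) = Pos x"

datatype formula =
    FConst bool
  | FVar nat
  | FNot formula
  | FAnd "formula list"
  | FOr "formula list"

primrec eval :: "(nat \<Rightarrow> bool) \<Rightarrow> formula \<Rightarrow> bool" where
  "eval w (FConst b) = b"
| "eval w (FVar x) = w x"
| "eval w (FNot f) = (\<not> eval w f)"
| "eval w (FAnd fs) = list_all (\<lambda>b. b) (map (eval w) fs)"
| "eval w (FOr fs) = list_ex (\<lambda>b. b) (map (eval w) fs)"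

definition equivalent :: "formula \<Rightarrow> formula \<Rightarrow> bool" where
  "equivalent f g \<longleftrightarrow> (\<forall>w. eval w f = eval w g)"

fun lit_formula :: "lit \<Rightarrow> formula" where
  "lit_formula (Pos x) = FVar x"
| "lit_formula (Neg x) = FNot (FVar x)"

primrec subst_const :: "nat \<Rightarrow> bool \<Rightarrow> formula \<Rightarrow> formula" where
  "subst_const x c (FConst b) = FConst b"
| "subst_const x c (FVar y) = (if y = x then FConst c else FVar y)"
| "subst_const x c (FNot f) = FNot (subst_const x c f)"
| "subst_const x c (FAnd fs) = FAnd (map (subst_const x c) fs)"
| "subst_const x c (FOr fs) = FOr (map (subst_const x c) fs)"

fun condition :: "formula \<Rightarrow> lit \<Rightarrow> formula" where
  "condition f (Pos x) = subst_const x True f"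
| "condition f (Neg x) = subst_const x False f"

definition forall_lit :: "lit \<Rightarrow> formula \<Rightarrow> formula" where
  "forall_lit l f = FAnd [FOr [lit_formula l, condition f (compl l)], condition f l]"

definition forall_lits :: "lit list \<Rightarrow> formula \<Rightarrow> formula" where
  "forall_lits ls f = foldr forall_lit ls f"

section \<open>NNF circuits\<close>

datatype gate = Const bool | Lit lit | And "nat list" | Or "nat list"

text \<open>The nodes of a circuit are the positions in its list of gates; the numbers
  carried by an and-gate or or-gate are its children.\<close>

datatype circuit = Circuit (gates: "gate list") (top_node: nat)

fun children :: "gate \<Rightarrow> nat list" where
  "children (And js) = js"
| "children (Or js) = js"
| "children _ = []"

definition edges :: "circuit \<Rightarrow> (nat \<times> nat) set" where
  "edges C = {(i, j). i < length (gates C) \<and> j \<in> set (children (gates C ! i))}"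

text \<open>Nodes plus edges, with parallel edges counted separately.\<close>

definition circuit_size :: "circuit \<Rightarrow> nat" where
  "circuit_size C = length (gates C) + (\<Sum>g\<leftarrow>gates C. length (children g))"

definition nnf_circuit :: "circuit \<Rightarrow> bool" where
  "nnf_circuit C \<longleftrightarrow>
     top_node C < length (gates C) \<and>
     edges C \<subseteq> {..<length (gates C)} \<times> {..<length (gates C)} \<and>
     acyclic (edges C) \<and>
     (\<forall>i < length (gates C). (top_node C, i) \<in> (edges C)\<^sup>*) \<and>
     And [] \<notin> set (gates C) \<and> Or [] \<notin> set (gates C)"

definition node_vars :: "circuit \<Rightarrow> nat \<Rightarrow> nat set" where
  "node_vars C i = {lit_var l | l j. (i, j) \<in> (edges C)\<^sup>* \<and> j < length (gates C) \<and> gates C ! j = Lit l}"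

definition circuit_vars :: "circuit \<Rightarrow> nat set" where
  "circuit_vars C = node_vars C (top_node C)"

definition decomposable :: "circuit \<Rightarrow> bool" where
  "decomposable C \<longleftrightarrow>
     (\<forall>i < length (gates C). \<forall>js. gates C ! i = And js \<longrightarrow>
        (\<forall>a < length js. \<forall>b < length js. a \<noteq> b \<longrightarrow>
           node_vars C (js ! a) \<inter> node_vars C (js ! b) = {}))"

text \<open>Node \<open>p\<close> is the binary conjunction of a leaf labelled \<open>l\<close> and node \<open>a\<close>, in either order.\<close>

definition lit_conj :: "circuit \<Rightarrow> nat \<Rightarrow> lit \<Rightarrow> nat \<Rightarrow> bool" where
  "lit_conj C p l a \<longleftrightarrow>
     (\<exists>m. gates C ! m = Lit l \<and> (gates C ! p = And [m, a] \<or> gates C ! p = And [a, m]))"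

definition decision_dnnf :: "circuit \<Rightarrow> bool" where
  "decision_dnnf C \<longleftrightarrow> nnf_circuit C \<and> decomposable C \<and>
     (\<forall>i < length (gates C). \<forall>js. gates C ! i = Or js \<longrightarrow>
        (\<exists>l p q a b. js = [p, q] \<and> lit_conj C p l a \<and> lit_conj C q (compl l) b))"

text \<open>The formula denoted by a node is obtained by unfolding the graph below it.  The
  test on \<open>C\<close> only secures termination.\<close>

function node_formula :: "circuit \<Rightarrow> nat \<Rightarrow> formula" where
  "node_formula C i =
     (if nnf_circuit C \<and> i < length (gates C) then
        (case gates C ! i of
           Const b \<Rightarrow> FConst b
         | Lit l \<Rightarrow> lit_formula l
         | And js \<Rightarrow> FAnd (map (node_formula C) js)
         | Or js \<Rightarrow> FOr (map (node_formula C) js))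
      else FConst False)"
  by pat_completeness auto
termination
proof -
  let ?R = "{((D, j), (C, i)). D = C \<and> nnf_circuit C \<and> (i, j) \<in> edges C}"
  have wfC: "wf ((edges C)\<inverse>)" if "nnf_circuit C" for C
  proof (rule finite_acyclic_wf_converse)
    show "finite (edges C)"
      using that finite_subset[of "edges C"] by (auto simp: nnf_circuit_def)
    show "acyclic (edges C)" using that by (simp add: nnf_circuit_def)
  qed
  have "wf ?R"
  proof (rule wfI_min)
    fix x :: "circuit \<times> nat" and Q assume "x \<in> Q"
    obtain C i where x: "x = (C, i)" by force
    show "\<exists>z\<in>Q. \<forall>y. (y, z) \<in> ?R \<longrightarrow> y \<notin> Q"
    proof (cases "nnf_circuit C")
      case True
      have "i \<in> {k. (C, k) \<in> Q}" using \<open>x \<in> Q\<close> x by simp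
      from wfE_min[OF wfC[OF True] this]
      obtain k where "(C, k) \<in> Q" "\<And>j. (j, k) \<in> (edges C)\<inverse> \<Longrightarrow> (C, j) \<notin> Q" by auto
      then show ?thesis by (intro bexI[of _ "(C, k)"]) auto
    next
      case False
      then show ?thesis using \<open>x \<in> Q\<close> x by (intro bexI[of _ "(C, i)"]) auto
    qed
  qed
  then show ?thesis by (rule local.termination) (auto simp: edges_def)
qed

declare node_formula.simps [simp del]

definition circuit_formula :: "circuit \<Rightarrow> formula" where
  "circuit_formula C = node_formula C (top_node C)"

section \<open>Programs and their running time\<close>

text \<open>Algorithms are while-programs over registers and unbounded arrays of natural numbers
  (a random access machine with structured control) that have addition and truncated subtraction
  as their only arithmetic.  The cost is uniform: every operator, constant, register access, array
  access, assignment and test that is executed takes one unit of time.  The constructors of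
  \<open>name\<close> separate the registers and arrays that carry the input, those that carry the output,
  and those used as working storage.\<close>

datatype name = In string | Out string | Work string

datatype aexp =
    Num nat
  | Reg name
  | Cell name aexp
  | Plus aexp aexp
  | Minus aexp aexp

datatype test = Equal aexp aexp | Less aexp aexp

datatype com =
    Skip
  | Assign name aexp
  | Write name aexp aexp
  | Seq com com
  | Cond test com com
  | While test com

datatype state = State (reg: "name \<Rightarrow> nat") (arr: "name \<Rightarrow> nat \<Rightarrow> nat")

primrec aval :: "aexp \<Rightarrow> state \<Rightarrow> nat" where
  "aval (Num n) s = n"
| "aval (Reg x) s = reg s x"
| "aval (Cell a e) s = arr s a (aval e s)"
| "aval (Plus e f) s = aval e s + aval f s"
| "aval (Minus e f) s = aval e s - aval f s"

primrec acost :: "aexp \<Rightarrow> nat" where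
  "acost (Num n) = 1"
| "acost (Reg x) = 1"
| "acost (Cell a e) = 1 + acost e"
| "acost (Plus e f) = 1 + acost e + acost f"
| "acost (Minus e f) = 1 + acost e + acost f"

primrec tval :: "test \<Rightarrow> state \<Rightarrow> bool" where
  "tval (Equal e f) s = (aval e s = aval f s)"
| "tval (Less e f) s = (aval e s < aval f s)"

primrec tcost :: "test \<Rightarrow> nat" where
  "tcost (Equal e f) = 1 + acost e + acost f"
| "tcost (Less e f) = 1 + acost e + acost f"

definition set_reg :: "name \<Rightarrow> nat \<Rightarrow> state \<Rightarrow> state" where
  "set_reg x v s = State ((reg s)(x := v)) (arr s)"

definition set_cell :: "name \<Rightarrow> nat \<Rightarrow> nat \<Rightarrow> state \<Rightarrow> state" where
  "set_cell a k v s = State (reg s) ((arr s)(a := (arr s a)(k := v)))"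

text \<open>\<open>exec P s t s'\<close>: program \<open>P\<close> started in state \<open>s\<close> halts in state \<open>s'\<close> after \<open>t\<close> units of time.\<close>

inductive exec :: "com \<Rightarrow> state \<Rightarrow> nat \<Rightarrow> state \<Rightarrow> bool" where
  Skip: "exec Skip s 1 s"
| Assign: "exec (Assign x e) s (1 + acost e) (set_reg x (aval e s) s)"
| Write: "exec (Write a e f) s (1 + acost e + acost f) (set_cell a (aval e s) (aval f s) s)"
| Seq: "exec P s t s' \<Longrightarrow> exec Q s' u s'' \<Longrightarrow> exec (Seq P Q) s (t + u) s''"
| CondTrue: "tval b s \<Longrightarrow> exec P s t s' \<Longrightarrow> exec (Cond b P Q) s (tcost b + t) s'"
| CondFalse: "\<not> tval b s \<Longrightarrow> exec Q s t s' \<Longrightarrow> exec (Cond b P Q) s (tcost b + t) s'"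
| WhileFalse: "\<not> tval b s \<Longrightarrow> exec (While b P) s (tcost b) s"
| WhileTrue: "tval b s \<Longrightarrow> exec P s t s' \<Longrightarrow> exec (While b P) s' u s'' \<Longrightarrow>
    exec (While b P) s (tcost b + t + u) s''"

section \<open>Circuits and literals in memory\<close>

text \<open>Adjacency lists: the record of node \<open>i\<close> consists of the \<open>i\<close>-th cells of the arrays \<open>kind\<close>,
  \<open>fst\<close> and \<open>snd\<close>.  For an internal node, \<open>fst\<close> is the position in the array \<open>child\<close> where its
  children are listed and \<open>snd\<close> is their number.\<close>

fun stores_gate :: "(string \<Rightarrow> name) \<Rightarrow> state \<Rightarrow> nat \<Rightarrow> gate \<Rightarrow> bool" where
  "stores_gate io s i (Const b) \<longleftrightarrow>
     arr s (io ''kind'') i = 0 \<and> arr s (io ''fst'') i = of_bool b"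
| "stores_gate io s i (Lit l) \<longleftrightarrow>
     arr s (io ''kind'') i = 1 \<and> arr s (io ''fst'') i = (case l of Pos _ \<Rightarrow> 1 | Neg _ \<Rightarrow> 0) \<and>
     arr s (io ''snd'') i = lit_var l"
| "stores_gate io s i (And js) \<longleftrightarrow>
     arr s (io ''kind'') i = 2 \<and> arr s (io ''snd'') i = length js \<and>
     (\<forall>k < length js. arr s (io ''child'') (arr s (io ''fst'') i + k) = js ! k)"
| "stores_gate io s i (Or js) \<longleftrightarrow>
     arr s (io ''kind'') i = 3 \<and> arr s (io ''snd'') i = length js \<and>
     (\<forall>k < length js. arr s (io ''child'') (arr s (io ''fst'') i + k) = js ! k)"

definition stores_circuit :: "(string \<Rightarrow> name) \<Rightarrow> state \<Rightarrow> circuit \<Rightarrow> bool" where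
  "stores_circuit io s C \<longleftrightarrow>
     reg s (io ''nodes'') = length (gates C) \<and> reg s (io ''root'') = top_node C \<and>
     (\<forall>i < length (gates C). stores_gate io s i (gates C ! i))"

definition stores_lits :: "(string \<Rightarrow> name) \<Rightarrow> state \<Rightarrow> lit list \<Rightarrow> bool" where
  "stores_lits io s ls \<longleftrightarrow>
     reg s (io ''lits'') = length ls \<and>
     (\<forall>i < length ls. arr s (io ''lit_sign'') i = (case ls ! i of Pos _ \<Rightarrow> 1 | Neg _ \<Rightarrow> 0) \<and>
        arr s (io ''lit_var'') i = lit_var (ls ! i))"

text \<open>Initially all arrays other than the input arrays are zero; nothing is assumed about
  registers and array cells that do not belong to the input representation.\<close>

definition input_state :: "circuit \<Rightarrow> lit list \<Rightarrow> state \<Rightarrow> bool" where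
  "input_state C ls s \<longleftrightarrow> stores_circuit In s C \<and> stores_lits In s ls \<and>
     (\<forall>a k. arr s (Out a) k = 0 \<and> arr s (Work a) k = 0)"

end

theory Submission
  imports Defs
begin

text \<open>
  Write \<open>flips S w\<close> for the assignments that arise from \<open>w\<close> by making some literals of \<open>S\<close> true.
  Then \<open>\<forall>S. \<phi>\<close> holds at \<open>w\<close> iff \<open>\<phi>\<close> holds throughout \<open>flips S w\<close>.  So quantification commutes with
  conjunctions, sends a literal to itself or, if its complement is in \<open>S\<close>, to false, and sends a
  decision node \<open>p \<or> q\<close> with \<open>p = \<ell> \<and> \<alpha>\<close> and \<open>q = \<not>\<ell> \<and> \<beta>\<close>, where \<open>\<alpha>\<close> and \<open>\<beta>\<close> do not mention the
  variable of \<open>\<ell>\<close>, to \<open>\<forall>S. p \<or> \<forall>S. q \<or> (\<forall>S. \<alpha> \<and> \<forall>S. \<beta>)\<close>.  This is a local modification of the circuit: one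
  pass over the nodes in any order performs it, adding at most one and-node per decision node.
\<close>

section \<open>Semantics of universal literal quantification\<close>

definition true_lit :: "bool \<Rightarrow> nat \<Rightarrow> lit" where
  "true_lit b x = (if b then Pos x else Neg x)"

definition flips :: "lit set \<Rightarrow> (nat \<Rightarrow> bool) \<Rightarrow> (nat \<Rightarrow> bool) set" where
  "flips S w = {w'. \<forall>x. w' x \<noteq> w x \<longrightarrow> true_lit (w' x) x \<in> S}"

definition make_true :: "lit \<Rightarrow> (nat \<Rightarrow> bool) \<Rightarrow> nat \<Rightarrow> bool" where
  "make_true l w = w(lit_var l := (case l of Pos _ \<Rightarrow> True | Neg _ \<Rightarrow> False))"

lemma eval_subst_const: "eval w (subst_const x c f) = eval (w(x := c)) f"
  by (induction f) (auto simp: list_all_iff list_ex_iff)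

lemma eval_condition: "eval w (condition f l) = eval (make_true l w) f"
  by (cases l) (auto simp: eval_subst_const make_true_def)

lemma lit_var_compl [simp]: "lit_var (compl l) = lit_var l"
  by (cases l) auto

lemma compl_compl [simp]: "compl (compl l) = l"
  by (cases l) auto

lemma eval_compl [simp]: "eval w (lit_formula (compl l)) = (\<not> eval w (lit_formula l))"
  by (cases l) auto

lemma make_true_same: "eval w (lit_formula l) \<Longrightarrow> make_true l w = w"
  by (cases l) (auto simp: make_true_def fun_eq_iff)

lemma eval_make_true [simp]: "eval (make_true l w) (lit_formula l)"
  by (cases l) (auto simp: make_true_def)

text \<open>Where \<open>l\<close> holds, the first conjunct of \<open>forall_lit\<close> is true
  and setting \<open>l\<close> changes nothing. Where \<open>l\<close> fails, conditioning on
  \<open>compl l\<close> leaves \<open>w\<close> as it is, so the first conjunct is \<open>f\<close>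
  at \<open>w\<close>.\<close>

lemma eval_forall_lit:
  "eval w (forall_lit l f) \<longleftrightarrow> eval w f \<and> eval (make_true l w) f"
proof (cases "eval w (lit_formula l)")
  case True
  then show ?thesis by (simp add: forall_lit_def eval_condition make_true_same)
next
  case False
  then have "make_true (compl l) w = w" by (intro make_true_same) simp
  with False show ?thesis by (simp add: forall_lit_def eval_condition)
qed

text \<open>Membership in \<open>flips\<close> is a condition on each variable separately. Away from
  \<open>lit_var l\<close> both sides impose the same one; at \<open>lit_var l\<close> finitely many
  cases remain.\<close>

lemma flips_insert: "flips (insert l S) w = flips S w \<union> flips S (make_true l w)"
proof (rule set_eqI)
  fix w'
  have split: "w' \<in> flips T v \<longleftrightarrow> (w' (lit_var l) \<noteq> v (lit_var l) \<longrightarrow> true_lit (w' (lit_var l)) (lit_var l) \<in> T) \<and>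
      (\<forall>x. x \<noteq> lit_var l \<longrightarrow> w' x \<noteq> v x \<longrightarrow> true_lit (w' x) x \<in> T)" for T v
    unfolding flips_def mem_Collect_eq by metis
  have other: "true_lit b x \<noteq> l" if "x \<noteq> lit_var l" for b x
    using that by (auto simp: true_lit_def)
  show "w' \<in> flips (insert l S) w \<longleftrightarrow> w' \<in> flips S w \<union> flips S (make_true l w)"
    using other unfolding Un_iff split
    by (cases l; cases "w' (lit_var l)"; cases "w (lit_var l)")
      (auto simp: make_true_def true_lit_def)
qed

lemma flips_refl [simp]: "w \<in> flips S w"
  by (simp add: flips_def)

lemma flips_empty [simp]: "flips {} w = {w}"
  by (auto simp: flips_def)

text \<open>The head of the list is the outermost quantifier, so \<open>w\<close> splits into
  \<open>w\<close> and \<open>make_true l w\<close>. The induction hypothesis is applied at both,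
  and \<open>flips_insert\<close> joins the results.\<close>

lemma eval_forall_lits:
  "eval w (forall_lits ls f) \<longleftrightarrow> (\<forall>w' \<in> flips (set ls) w. eval w' f)"
  by (induction ls arbitrary: w)
    (auto simp: forall_lits_def eval_forall_lit flips_insert)

text \<open>If \<open>compl l\<close> is in \<open>S\<close>, then
  \<open>make_true (compl l) w\<close> is a flip that falsifies \<open>l\<close>. Otherwise no flip
  can turn \<open>l\<close> from true to false.\<close>

lemma forall_flips_lit:
  "(\<forall>w' \<in> flips S w. eval w' (lit_formula l)) \<longleftrightarrow> eval w (lit_formula l) \<and> compl l \<notin> S"
proof -
  have "make_true (compl l) w \<in> flips S w" if "compl l \<in> S"
    using that by (cases l) (auto simp: flips_def make_true_def true_lit_def)
  moreover have "\<not> eval (make_true (compl l) w) (lit_formula l)"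
    using eval_make_true[of "compl l" w] by (simp del: eval_make_true)
  moreover have "eval w' (lit_formula l)"
    if "w' \<in> flips S w" "eval w (lit_formula l)" "compl l \<notin> S" for w'
    using that by (cases l) (auto simp: flips_def true_lit_def)
  ultimately show ?thesis using flips_refl by blast
qed

text \<open>If \<open>l\<close> holds at \<open>w\<close>, making it true restores the value at
  \<open>w\<close>; if \<open>l\<close> is in \<open>S\<close>, the change is permitted.\<close>

lemma make_true_flips:
  assumes "w' \<in> flips S w" and "l \<in> S \<or> eval w (lit_formula l)"
  shows "make_true l w' \<in> flips S w"
  using assms by (cases l) (auto simp: flips_def make_true_def true_lit_def)

text \<open>The resolvent \<open>a \<and> b\<close> covers the case where \<open>l\<close> may be flipped: then both branches are
  tested, and neither of them sees the flip.\<close>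

lemma forall_flips_decision:
  assumes a: "\<And>m w. lit_var m = lit_var l \<Longrightarrow> A (make_true m w) = A w"
    and b: "\<And>m w. lit_var m = lit_var l \<Longrightarrow> B (make_true m w) = B w"
  shows "(\<forall>w' \<in> flips S w. eval w' (lit_formula l) \<and> A w' \<or> \<not> eval w' (lit_formula l) \<and> B w') \<longleftrightarrow>
    (\<forall>w' \<in> flips S w. eval w' (lit_formula l) \<and> A w') \<or>
    (\<forall>w' \<in> flips S w. \<not> eval w' (lit_formula l) \<and> B w') \<or>
    (\<forall>w' \<in> flips S w. A w') \<and> (\<forall>w' \<in> flips S w. B w')"
  (is "?L = ?R")
proof
  assume L: ?L
  \<comment> \<open>A free literal can be made true in any flip without leaving
    \<open>flips S w\<close>, by \<open>make_true_flips\<close>.\<close>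
  let ?free = "\<lambda>m. m \<in> S \<or> eval w (lit_formula m)"
  show ?R
  proof (cases "?free l \<and> ?free (compl l)")
    case True
    have "A w' \<and> B w'" if "w' \<in> flips S w" for w'
    proof
      have "make_true l w' \<in> flips S w" "make_true (compl l) w' \<in> flips S w"
        using True that make_true_flips by blast+
      moreover have "\<not> eval (make_true (compl l) w') (lit_formula l)"
        using eval_make_true[of "compl l" w'] by (simp del: eval_make_true)
      ultimately have "A (make_true l w')" "B (make_true (compl l) w')"
        using L eval_make_true[of l w'] by blast+
      then show "A w'" "B w'" using a b by simp_all
    qed
    then show ?thesis by blast
  next
    case False
    \<comment> \<open>A literal that is not free is false throughout \<open>flips S w\<close>, so
      every flip takes the same branch of the decision.\<close>
    then consider "compl l \<notin> S" "eval w (lit_formula l)" | "l \<notin> S" "\<not> eval w (lit_formula l)"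
      by auto
    then show ?thesis
    proof cases
      case 1
      then have "\<forall>w' \<in> flips S w. eval w' (lit_formula l)"
        using forall_flips_lit[of S w l] by blast
      with L show ?thesis by blast
    next
      case 2
      then have "\<forall>w' \<in> flips S w. eval w' (lit_formula (compl l))"
        using forall_flips_lit[of S w "compl l"] by simp
      with L show ?thesis by auto
    qed
  qed
qed blast

section \<open>The quantified circuit\<close>

text \<open>The rank of a node is the number of its proper descendants. A child has fewer: its
  descendants are among those of the parent, and by acyclicity the child itself is not among its
  own. The rank serves for induction over nodes and for the acyclicity of the new circuit.\<close>

lemma circuit_rank:
  assumes "nnf_circuit C"
  shows "\<exists>r :: nat \<Rightarrow> nat. \<forall>i j. (i, j) \<in> edges C \<longrightarrow> r j < r i"
proof (intro exI allI impI)
  fix i j assume ij: "(i, j) \<in> edges C"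
  let ?n = "length (gates C)"
  have E: "edges C \<subseteq> {..<?n} \<times> {..<?n}" "acyclic (edges C)"
    using assms by (auto simp: nnf_circuit_def)
  have "finite ((edges C)\<^sup>+)"
    using finite_subset[OF E(1)] by (simp add: finite_trancl)
  then have "finite ((edges C)\<^sup>+ `` {i})" by simp
  moreover have "j \<in> (edges C)\<^sup>+ `` {i}" "j \<notin> (edges C)\<^sup>+ `` {j}"
    using ij E(2) by (auto simp: acyclic_def)
  moreover have "(edges C)\<^sup>+ `` {j} \<subseteq> (edges C)\<^sup>+ `` {i}"
    using ij by (auto intro: trancl_into_trancl2)
  ultimately show "card ((edges C)\<^sup>+ `` {j}) < card ((edges C)\<^sup>+ `` {i})"
    by (intro psubset_card_mono) auto
qed

lemma child_edge:
  "\<lbrakk>i < length (gates C); j \<in> set (children (gates C ! i))\<rbrakk> \<Longrightarrow> (i, j) \<in> edges C"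
  by (simp add: edges_def)

lemma child_bound:
  "\<lbrakk>nnf_circuit C; i < length (gates C); j \<in> set (children (gates C ! i))\<rbrakk> \<Longrightarrow> j < length (gates C)"
  using child_edge[of i C j] by (auto simp: nnf_circuit_def)

lemma eval_node:
  assumes "nnf_circuit C" "i < length (gates C)"
  shows "eval w (node_formula C i) = (case gates C ! i of
    Const b \<Rightarrow> b
  | Lit l \<Rightarrow> eval w (lit_formula l)
  | And js \<Rightarrow> (\<forall>j \<in> set js. eval w (node_formula C j))
  | Or js \<Rightarrow> (\<exists>j \<in> set js. eval w (node_formula C j)))"
  using assms by (subst node_formula.simps)
    (auto split: gate.split simp: list_all_iff list_ex_iff)

lemma node_vars_child: "(i, j) \<in> edges C \<Longrightarrow> node_vars C j \<subseteq> node_vars C i"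
  unfolding node_vars_def by (blast intro: converse_rtrancl_into_rtrancl)

text \<open>This supplies the independence hypotheses of \<open>forall_flips_decision\<close>: a
  branch without the decision variable does not notice \<open>make_true\<close>.\<close>

lemma eval_node_cong:
  assumes C: "nnf_circuit C"
  shows "i < length (gates C) \<Longrightarrow> (\<And>x. x \<in> node_vars C i \<Longrightarrow> v x = w x) \<Longrightarrow>
    eval v (node_formula C i) = eval w (node_formula C i)"
proof -
  obtain r :: "nat \<Rightarrow> nat" where r: "\<And>i j. (i, j) \<in> edges C \<Longrightarrow> r j < r i"
    using circuit_rank[OF C] by blast
  show "i < length (gates C) \<Longrightarrow> (\<And>x. x \<in> node_vars C i \<Longrightarrow> v x = w x) \<Longrightarrow>
    eval v (node_formula C i) = eval w (node_formula C i)"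
  proof (induction "r i" arbitrary: i rule: less_induct)
    case less
    have sub: "eval v (node_formula C j) = eval w (node_formula C j)"
      if "j \<in> set (children (gates C ! i))" for j
    proof (rule less.hyps)
      note e = child_edge[OF less.prems(1) that]
      show "r j < r i" using r[OF e] .
      show "j < length (gates C)" using child_bound[OF C less.prems(1) that] .
      show "v x = w x" if "x \<in> node_vars C j" for x
        using less.prems(2) node_vars_child[OF e] that by blast
    qed
    show ?case
    proof (cases "gates C ! i")
      case (Lit l)
      then have "lit_var l \<in> node_vars C i"
        using less.prems(1) by (auto simp: node_vars_def)
      then have "v (lit_var l) = w (lit_var l)" by (rule less.prems(2))
      then have "eval v (lit_formula l) = eval w (lit_formula l)" by (cases l) auto
      with Lit show ?thesis by (simp add: eval_node[OF C less.prems(1)])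
    qed (use sub in \<open>auto simp: eval_node[OF C less.prems(1)]\<close>)
  qed
qed

section \<open>Resolvents and the construction of the circuit\<close>

definition opposite :: "circuit \<Rightarrow> nat \<Rightarrow> nat \<Rightarrow> bool" where
  "opposite C m m' \<longleftrightarrow> (\<exists>l. gates C ! m = Lit l \<and> gates C ! m' = Lit (compl l))"

text \<open>The branches may list literal and subcircuit in either order, so the complementary
  leaves are searched for. The last case needs no test: in a decision node it is the only one
  left.\<close>

definition resolvent :: "circuit \<Rightarrow> nat \<Rightarrow> nat \<Rightarrow> nat list" where
  "resolvent C p q =
     (let c = (!) (children (gates C ! p)); d = (!) (children (gates C ! q)) in
      if opposite C (c 0) (d 0) then [c 1, d 1]
      else if opposite C (c 0) (d 1) then [c 1, d 0]
      else if opposite C (c 1) (d 0) then [c 0, d 1]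
      else [c 0, d 0])"

text \<open>If the branches consist of literals only, the complementary pair found first need not be
  the one that \<open>decision_dnnf\<close> provides. Any such pair exhibits the node as a decision,
  so \<open>l\<close>, \<open>a\<close> and \<open>b\<close> are chosen anew to fit the
  search.\<close>

lemma decision_resolvent:
  assumes "decision_dnnf C" "i < length (gates C)" "gates C ! i = Or js"
  obtains p q l a b where "js = [p, q]" "lit_conj C p l a" "lit_conj C q (compl l) b"
    "resolvent C p q = [a, b]"
proof -
  from assms obtain p q l a b
    where js: "js = [p, q]" and p: "lit_conj C p l a" and q: "lit_conj C q (compl l) b"
    unfolding decision_dnnf_def by blast
  from p obtain c1 c2 where c: "gates C ! p = And [c1, c2]"
    and c': "c1 = a \<and> gates C ! c2 = Lit l \<or> c2 = a \<and> gates C ! c1 = Lit l"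
    by (auto simp: lit_conj_def)
  from q obtain d1 d2 where d: "gates C ! q = And [d1, d2]"
    and d': "d1 = b \<and> gates C ! d2 = Lit (compl l) \<or> d2 = b \<and> gates C ! d1 = Lit (compl l)"
    by (auto simp: lit_conj_def)
  have found: "\<exists>l. lit_conj C p l x \<and> lit_conj C q (compl l) y"
    if "opposite C m m'" "m = c1 \<and> x = c2 \<or> m = c2 \<and> x = c1" "m' = d1 \<and> y = d2 \<or> m' = d2 \<and> y = d1"
    for m m' x y
    using that unfolding opposite_def lit_conj_def c d by blast
  consider "opposite C c1 d1" | "\<not> opposite C c1 d1" "opposite C c1 d2"
    | "\<not> opposite C c1 d1" "\<not> opposite C c1 d2" "opposite C c2 d1"
    | "\<not> opposite C c1 d1" "\<not> opposite C c1 d2" "\<not> opposite C c2 d1" "opposite C c2 d2"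
    using c' d' unfolding opposite_def by blast
  then have "\<exists>a b. (\<exists>l. lit_conj C p l a \<and> lit_conj C q (compl l) b) \<and> resolvent C p q = [a, b]"
    by cases (use found in \<open>simp_all add: resolvent_def Let_def c d\<close>)
  then show ?thesis using js that by blast
qed

definition main_gate :: "circuit \<Rightarrow> lit set \<Rightarrow> nat \<Rightarrow> gate" where
  "main_gate C S i = (case gates C ! i of
     Const b \<Rightarrow> Const b
   | Lit l \<Rightarrow> if compl l \<in> S then Const False else Lit l
   | And js \<Rightarrow> And js
   | Or js \<Rightarrow> Or (js @ [length (gates C) + i]))"

text \<open>Every node gets a reserved partner, so the and-node of decision node \<open>i\<close>
  has the known position \<open>length (gates C) + i\<close>. The partners of other nodes are filler
  leaves.\<close>

definition aux_gate :: "circuit \<Rightarrow> nat \<Rightarrow> gate" where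
  "aux_gate C i = (case gates C ! i of
     Or js \<Rightarrow> And (resolvent C (js ! 0) (js ! 1))
   | _ \<Rightarrow> Const False)"

text \<open>The tautology in the last but one gate has every other gate but the top one as a child;
  it makes all gates reachable, whatever the quantification has cut off.\<close>

definition quantified :: "circuit \<Rightarrow> lit set \<Rightarrow> circuit" where
  "quantified C S = (let n = length (gates C) in
     Circuit (map (main_gate C S) [0..<n] @ map (aux_gate C) [0..<n] @
       [Const True, Or [0..<2 * n + 1], And [top_node C, 2 * n + 1]]) (2 * n + 2))"

lemma length_quantified [simp]: "length (gates (quantified C S)) = 2 * length (gates C) + 3"
  by (simp add: quantified_def Let_def)

lemma top_quantified [simp]: "top_node (quantified C S) = 2 * length (gates C) + 2"
  by (simp add: quantified_def Let_def)

lemma nth_quantified: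
  fixes C S
  defines "n \<equiv> length (gates C)"
  shows "i < n \<Longrightarrow> gates (quantified C S) ! i = main_gate C S i"
    and "i < n \<Longrightarrow> gates (quantified C S) ! (n + i) = aux_gate C i"
    and "gates (quantified C S) ! (2 * n) = Const True"
    and "gates (quantified C S) ! Suc (2 * n) = Or [0..<Suc (2 * n)]"
    and "gates (quantified C S) ! Suc (Suc (2 * n)) = And [top_node C, Suc (2 * n)]"
  by (auto simp: quantified_def Let_def nth_append n_def)

lemma less_quantified_cases:
  fixes i n :: nat
  assumes "i < 2 * n + 3"
  obtains "i < n" | j where "j < n" "i = n + j" | "i = 2 * n" | "i = 2 * n + 1" | "i = 2 * n + 2"
  using assms that(1,3-) that(2)[of "i - n"] by linarith

lemma lit_conj_edges:
  assumes "nnf_circuit C" "p < length (gates C)" "lit_conj C p l a"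
  shows "(p, a) \<in> edges C" "a < length (gates C)"
  using assms child_edge[of p C a] child_bound[of C p a] by (auto simp: lit_conj_def)

text \<open>The third case is the essential one: an edge out of a resolvent leads two levels down in
  \<open>C\<close>, past a branch \<open>p\<close>.\<close>

lemma edges_quantified:
  assumes C: "decision_dnnf C" and e: "(i, j) \<in> edges (quantified C S)"
  defines "n \<equiv> length (gates C)"
  obtains "i < n" "(i, j) \<in> edges C" | "i < n" "j = n + i"
  | k p where "k < n" "i = n + k" "(k, p) \<in> edges C" "(p, j) \<in> edges C"
  | "i = 2 * n + 1" "j < 2 * n + 1" | "i = 2 * n + 2" "j = top_node C \<or> j = 2 * n + 1"
proof -
  have nnf: "nnf_circuit C" using C by (simp add: decision_dnnf_def)
  note nth = nth_quantified[where C = C and S = S, folded n_def]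
  from e have i: "i < 2 * n + 3" and j: "j \<in> set (children (gates (quantified C S) ! i))"
    by (auto simp: edges_def n_def)
  from i show ?thesis
  proof (cases rule: less_quantified_cases)
    case 1
    with j show ?thesis
      using that(1,2) child_edge[of i C j]
      by (auto simp: nth main_gate_def n_def split: gate.splits if_splits)
  next
    case (2 k)
    with j obtain js where js: "gates C ! k = Or js" and j: "j \<in> set (resolvent C (js ! 0) (js ! 1))"
      by (auto simp: nth aux_gate_def split: gate.splits)
    have k: "k < length (gates C)" using 2 by (simp add: n_def)
    obtain p q l a b where pq: "js = [p, q]" "lit_conj C p l a" "lit_conj C q (compl l) b"
      "resolvent C p q = [a, b]" using decision_resolvent[OF C k js] .
    have kp: "(k, p) \<in> edges C" "(k, q) \<in> edges C"
      using child_edge[OF k] js pq(1) by auto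
    then have "p < n" "q < n" using nnf by (auto simp: nnf_circuit_def n_def)
    then have "(p, a) \<in> edges C" "(q, b) \<in> edges C"
      using lit_conj_edges[OF nnf] pq by (auto simp: n_def)
    moreover from j pq have "j = a \<or> j = b" by auto
    ultimately show ?thesis using that(3) 2 kp by blast
  qed (use j that in \<open>auto simp: nth\<close>)
qed

lemma nnf_quantified:
  assumes C: "decision_dnnf C"
  shows "nnf_circuit (quantified C S)"
proof -
  define n where "n = length (gates C)"
  let ?D = "quantified C S"
  note nth = nth_quantified[where C = C and S = S, folded n_def]
  have nnf: "nnf_circuit C" using C by (simp add: decision_dnnf_def)
  then have top: "top_node C < n" and
    bound: "\<And>i j. (i, j) \<in> edges C \<Longrightarrow> i < n \<and> j < n" and
    ne: "And [] \<notin> set (gates C)"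
    by (auto simp: nnf_circuit_def n_def)
  obtain r :: "nat \<Rightarrow> nat" where r: "\<And>i j. (i, j) \<in> edges C \<Longrightarrow> r j < r i"
    using circuit_rank[OF nnf] by blast
  define M where "M = Max (r ` {..<n})"
  have M: "r i \<le> M" if "i < n" for i unfolding M_def using that by auto
  \<comment> \<open>Doubling makes room for the resolvent of a node between that node and everything
    below it. The tautology and the top gate rank above all, as \<open>M\<close> bounds
    \<open>r\<close>.\<close>
  define r' where "r' i = (if i < n then 2 * r i + 1 else if i < 2 * n then 2 * r (i - n)
    else if i = 2 * n then 0 else if i = 2 * n + 1 then 2 * M + 2 else 2 * M + 3)" for i
  have "acyclic (edges ?D)"
  proof (rule acyclicI_order[where f = r'])
    fix i j assume "(i, j) \<in> edges ?D"
    with C show "r' j < r' i"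
    proof (cases rule: edges_quantified)
      case 1
      then show ?thesis using r bound by (fastforce simp: r'_def)
    next
      case (3 k p)
      then have "r j < r p" "r p < r k" "j < n" using r bound by blast+
      with 3 show ?thesis by (auto simp: r'_def n_def)
    next
      case 4
      then have "j < n \<or> n \<le> j \<and> j - n < n \<or> j = 2 * n" by (auto simp: n_def)
      with 4 show ?thesis using M[of j] M[of "j - n"] by (auto simp: r'_def n_def)
    next
      case 5
      then show ?thesis using top M[of "top_node C"] by (auto simp: r'_def n_def)
    qed (auto simp: r'_def n_def)
  qed
  moreover have "edges ?D \<subseteq> {..<2 * n + 3} \<times> {..<2 * n + 3}"
  proof clarify
    fix i j assume "(i, j) \<in> edges ?D"
    with C show "i \<in> {..<2 * n + 3} \<and> j \<in> {..<2 * n + 3}"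
      by (cases rule: edges_quantified) (use bound top in \<open>fastforce simp: n_def\<close>)+
  qed
  moreover have "(2 * n + 2, i) \<in> (edges ?D)\<^sup>*" if "i < 2 * n + 3" for i
  proof -
    have T: "(2 * n + 2, 2 * n + 1) \<in> edges ?D"
      by (intro child_edge) (simp_all add: nth, simp add: n_def)
    have "(2 * n + 1, i) \<in> edges ?D" if "i < 2 * n + 1"
      by (intro child_edge) (use that in \<open>auto simp: nth\<close>, simp add: n_def)
    with T that consider "i = 2 * n + 2" | "i = 2 * n + 1" | "(2 * n + 1, i) \<in> edges ?D"
      by linarith
    then show ?thesis by cases (use T in \<open>auto intro: converse_rtrancl_into_rtrancl\<close>)
  qed
  moreover have "children g \<noteq> []" if "g \<in> set (gates ?D)" "g = And js \<or> g = Or js" for g js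
  proof -
    from that(1) obtain i where "i < 2 * n + 3" and g: "g = gates ?D ! i"
      by (auto simp: in_set_conv_nth n_def)
    then show ?thesis
    proof (cases rule: less_quantified_cases)
      case 1
      then have "gates C ! i \<noteq> And []" using ne by (metis n_def nth_mem)
      with 1 g that(2) show ?thesis by (auto simp: nth main_gate_def split: gate.splits if_splits)
    qed (use g that(2) in \<open>auto simp: nth aux_gate_def resolvent_def Let_def split: gate.splits if_splits\<close>)
  qed
  then have "And [] \<notin> set (gates ?D)" "Or [] \<notin> set (gates ?D)" by fastforce+
  ultimately show ?thesis by (simp add: nnf_circuit_def n_def)
qed

section \<open>Correctness of the quantified circuit\<close>

lemma eval_lit_conj:
  assumes nnf: "nnf_circuit C" and p: "p < length (gates C)" "lit_conj C p l a"
  shows "eval w (node_formula C p) \<longleftrightarrow> eval w (lit_formula l) \<and> eval w (node_formula C a)"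
proof -
  from p(2) obtain m where m: "gates C ! m = Lit l" "gates C ! p = And [m, a] \<or> gates C ! p = And [a, m]"
    by (auto simp: lit_conj_def)
  then have "m < length (gates C)" using child_bound[OF nnf p(1), of m] by auto
  then show ?thesis using m by (auto simp: eval_node[OF nnf p(1)] eval_node[OF nnf])
qed

text \<open>This is where decomposability enters: the leaf \<open>m\<close> and the node
  \<open>a\<close> are distinct positions in the child list of one and-node.\<close>

lemma lit_conj_disjoint:
  assumes C: "decision_dnnf C" and p: "p < length (gates C)" "lit_conj C p l a"
  shows "lit_var l \<notin> node_vars C a"
proof -
  from p(2) obtain m js where m: "gates C ! m = Lit l" and
    js: "gates C ! p = And js" "js = [m, a] \<or> js = [a, m]"
    by (auto simp: lit_conj_def)
  then have "m < length (gates C)"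
    using C child_bound[of C p m] p(1) by (auto simp: decision_dnnf_def)
  then have "lit_var l \<in> node_vars C m" using m by (auto simp: node_vars_def)
  moreover have "node_vars C (js ! x) \<inter> node_vars C (js ! y) = {}"
    if "x < length js" "y < length js" "x \<noteq> y" for x y
    using C p(1) js(1) that unfolding decision_dnnf_def decomposable_def by blast
  from this[of 0 1] have "node_vars C m \<inter> node_vars C a = {}" using js(2) by auto
  ultimately show ?thesis by blast
qed

text \<open>Induction on the rank of \<open>i\<close> in \<open>C\<close>. Only or-nodes are
  substantial: there the third disjunct of \<open>forall_flips_decision\<close> is the value of the
  resolvent.\<close>

lemma eval_quantified_node:
  assumes C: "decision_dnnf C"
  shows "i < length (gates C) \<Longrightarrow> eval w (node_formula (quantified C S) i) \<longleftrightarrow>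
    (\<forall>w' \<in> flips S w. eval w' (node_formula C i))"
proof -
  let ?D = "quantified C S" and ?n = "length (gates C)"
  have nnf: "nnf_circuit C" using C by (simp add: decision_dnnf_def)
  note evalD = eval_node[OF nnf_quantified[OF C]]
  note nth = nth_quantified[where C = C and S = S]
  obtain r :: "nat \<Rightarrow> nat" where r: "\<And>i j. (i, j) \<in> edges C \<Longrightarrow> r j < r i"
    using circuit_rank[OF nnf] by blast
  show "i < ?n \<Longrightarrow> eval w (node_formula ?D i) \<longleftrightarrow>
    (\<forall>w' \<in> flips S w. eval w' (node_formula C i))"
  proof (induction "r i" arbitrary: i rule: less_induct)
    case less
    note i = less.prems
    \<comment> \<open>The transitive closure is taken because resolvents refer to grandchildren of
      \<open>i\<close>.\<close>
    have IH: "eval w (node_formula ?D j) = (\<forall>w' \<in> flips S w. eval w' (node_formula C j))"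
      if "(i, j) \<in> (edges C)\<^sup>+" for j
    proof (rule less.hyps)
      show "r j < r i" using that by (induction rule: trancl.induct) (use r less_trans in blast)+
      show "j < ?n" using that nnf by (auto simp: nnf_circuit_def elim: tranclE)
    qed
    have D: "eval w (node_formula ?D i) = (case main_gate C S i of
        Const b \<Rightarrow> b
      | Lit l \<Rightarrow> eval w (lit_formula l)
      | And js \<Rightarrow> (\<forall>j \<in> set js. eval w (node_formula ?D j))
      | Or js \<Rightarrow> (\<exists>j \<in> set js. eval w (node_formula ?D j)))"
      using i by (simp add: evalD nth)
    show ?case
    proof (cases "gates C ! i")
      case (Const b)
      \<comment> \<open>Over an empty set the constant false would be quantified to true.\<close>
      moreover have "flips S w \<noteq> {}" using flips_refl[of w S] by blast
      ultimately show ?thesis using i by (auto simp: D main_gate_def eval_node[OF nnf])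
    next
      case (Lit l)
      then show ?thesis using i
        by (simp add: D main_gate_def eval_node[OF nnf] forall_flips_lit)
    next
      case (And js)
      then have "(i, j) \<in> (edges C)\<^sup>+" if "j \<in> set js" for j
        using child_edge[OF i] that by auto
      with And IH i show ?thesis by (auto simp: D main_gate_def eval_node[OF nnf])
    next
      case (Or js)
      obtain p q l a b where pq: "js = [p, q]" "lit_conj C p l a" "lit_conj C q (compl l) b"
        "resolvent C p q = [a, b]" using decision_resolvent[OF C i Or] .
      have e: "(i, p) \<in> edges C" "(i, q) \<in> edges C"
        using child_edge[OF i] Or pq(1) by auto
      then have lt: "p < ?n" "q < ?n" using nnf by (auto simp: nnf_circuit_def)
      note pa = lit_conj_edges[OF nnf lt(1) pq(2)] and qb = lit_conj_edges[OF nnf lt(2) pq(3)]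
      have "lit_var l \<notin> node_vars C a" "lit_var l \<notin> node_vars C b"
        using lit_conj_disjoint[OF C] lt pq(2,3) by fastforce+
      then have indep: "eval (make_true m v) (node_formula C a) = eval v (node_formula C a)"
        "eval (make_true m v) (node_formula C b) = eval v (node_formula C b)"
        if "lit_var m = lit_var l" for m v
        using that pa(2) qb(2) by (intro eval_node_cong[OF nnf]; auto simp: make_true_def)+
      have "eval w (node_formula ?D (?n + i)) \<longleftrightarrow>
        eval w (node_formula ?D a) \<and> eval w (node_formula ?D b)"
        using i Or pq by (simp add: evalD nth aux_gate_def)
      then have "eval w (node_formula ?D i) \<longleftrightarrow>
        eval w (node_formula ?D p) \<or> eval w (node_formula ?D q) \<or>
        eval w (node_formula ?D a) \<and> eval w (node_formula ?D b)"
        using Or pq(1) by (simp add: D main_gate_def)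
      also have "\<dots> \<longleftrightarrow> (\<forall>w' \<in> flips S w. eval w' (node_formula C i))"
        using e pa(1) qb(1) IH[OF r_into_trancl, of p] IH[OF r_into_trancl, of q]
          IH[OF trancl_trans[OF r_into_trancl r_into_trancl], of p a]
          IH[OF trancl_trans[OF r_into_trancl r_into_trancl], of q b]
          forall_flips_decision[where A = "\<lambda>v. eval v (node_formula C a)"
            and B = "\<lambda>v. eval v (node_formula C b)" and l = l and S = S and w = w, OF indep]
        by (simp add: eval_node[OF nnf i] Or pq(1) eval_lit_conj[OF nnf lt(1) pq(2)]
            eval_lit_conj[OF nnf lt(2) pq(3)])
      finally show ?thesis .
    qed
  qed
qed

text \<open>The top gate conjoins the old top node with the or-gate \<open>2 * ?n + 1\<close>, which
  is true because the constant at \<open>2 * ?n\<close> is one of its children.\<close>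

lemma equivalent_quantified:
  assumes C: "decision_dnnf C"
  shows "equivalent (circuit_formula (quantified C (set ls))) (forall_lits ls (circuit_formula C))"
  unfolding equivalent_def
proof
  fix w
  let ?D = "quantified C (set ls)" and ?n = "length (gates C)"
  note evalD = eval_node[OF nnf_quantified[OF C]]
  note nth = nth_quantified[where C = C and S = "set ls"]
  have top: "top_node C < ?n" using C by (simp add: decision_dnnf_def nnf_circuit_def)
  have "eval w (node_formula ?D (2 * ?n))" by (simp add: evalD nth)
  then have "eval w (node_formula ?D (2 * ?n + 1))" by (simp add: evalD nth)
  then have "eval w (circuit_formula ?D) = eval w (node_formula ?D (top_node C))"
    by (simp add: circuit_formula_def evalD nth)
  also have "\<dots> = eval w (forall_lits ls (circuit_formula C))"
    using eval_quantified_node[OF C top] by (simp add: eval_forall_lits circuit_formula_def)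
  finally show "eval w (circuit_formula ?D) = eval w (forall_lits ls (circuit_formula C))" .
qed

section \<open>Bounds on the size of the output and the number of literals\<close>

lemma circuit_size_quantified:
  assumes C: "decision_dnnf C"
  shows "circuit_size (quantified C S) \<le> 13 * circuit_size C"
proof -
  let ?n = "length (gates C)"
  have top: "top_node C < ?n" using C by (simp add: decision_dnnf_def nnf_circuit_def)
  have "(\<Sum>i\<leftarrow>[0..<?n]. length (children (main_gate C S i)))
    \<le> (\<Sum>i\<leftarrow>[0..<?n]. length (children (gates C ! i)) + 1)"
    by (intro sum_list_mono) (auto simp: main_gate_def split: gate.splits)
  also have "\<dots> = (\<Sum>g\<leftarrow>gates C. length (children g)) + ?n"
  proof -
    have "map (\<lambda>i. length (children (gates C ! i))) [0..<?n] = map (\<lambda>g. length (children g)) (gates C)"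
      by (rule nth_equalityI) simp_all
    then show ?thesis by (subst sum_list_addf) (simp add: sum_list_triv)
  qed
  finally have 1: "(\<Sum>i\<leftarrow>[0..<?n]. length (children (main_gate C S i)))
    \<le> (\<Sum>g\<leftarrow>gates C. length (children g)) + ?n" .
  have "(\<Sum>i\<leftarrow>[0..<?n]. length (children (aux_gate C i))) \<le> (\<Sum>i\<leftarrow>[0..<?n]. 2)"
    by (intro sum_list_mono) (auto simp: aux_gate_def resolvent_def Let_def split: gate.splits)
  then have 2: "(\<Sum>i\<leftarrow>[0..<?n]. length (children (aux_gate C i))) \<le> 2 * ?n"
    by (simp add: sum_list_triv)
  \<comment> \<open>The last three gates have \<open>2 * ?n + 3\<close> outgoing edges. With
    \<open>2 * ?n + 3\<close> gates the size is at most \<open>7 * ?n + 6\<close> plus the number of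
    edges of \<open>C\<close>, and \<open>?n\<close> is positive.\<close>
  show ?thesis using 1 2 top
    by (simp add: circuit_size_def quantified_def Let_def comp_def del: upt_Suc)
qed

text \<open>A literal over a variable of the circuit is the label of a leaf or the complement of
  one, so there are at most two per leaf label.\<close>

lemma distinct_lits_bound:
  assumes "distinct ls"
  shows "length ls \<le> 2 * circuit_size C + card {l \<in> set ls. lit_var l \<notin> circuit_vars C}"
proof -
  let ?A = "Lit -` set (gates C)"
  have inj: "inj Lit" by (simp add: inj_def)
  have finA: "finite ?A" using finite_vimageI[OF _ inj] by blast
  have "card ?A \<le> card (set (gates C))" using card_vimage_inj_on_le[OF inj, of "set (gates C)"] by simp
  also have "\<dots> \<le> circuit_size C" using card_length[of "gates C"] by (simp add: circuit_size_def)
  finally have A: "card ?A \<le> circuit_size C" .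
  have same_var: "l = l' \<or> l = compl l'" if "lit_var l = lit_var l'" for l l'
    using that by (cases l; cases l') auto
  have "{l \<in> set ls. lit_var l \<in> circuit_vars C} \<subseteq> ?A \<union> compl ` ?A"
  proof
    fix l assume "l \<in> {l \<in> set ls. lit_var l \<in> circuit_vars C}"
    then obtain l' j where "lit_var l = lit_var l'" "j < length (gates C)" "gates C ! j = Lit l'"
      by (auto simp: circuit_vars_def node_vars_def)
    then have "l' \<in> ?A" "l = l' \<or> l = compl l'" using same_var nth_mem by fastforce+
    then show "l \<in> ?A \<union> compl ` ?A" by blast
  qed
  then have "card {l \<in> set ls. lit_var l \<in> circuit_vars C} \<le> card (?A \<union> compl ` ?A)"
    using finA by (intro card_mono) auto
  also have "\<dots> \<le> card ?A + card (compl ` ?A)" by (rule card_Un_le)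
  also have "\<dots> \<le> 2 * circuit_size C" using card_image_le[OF finA, of compl] A by linarith
  finally have 1: "card {l \<in> set ls. lit_var l \<in> circuit_vars C} \<le> 2 * circuit_size C" .
  have "length ls = card (set ls)" using assms by (simp add: distinct_card)
  also have "set ls = {l \<in> set ls. lit_var l \<in> circuit_vars C} \<union> {l \<in> set ls. lit_var l \<notin> circuit_vars C}"
    by blast
  also have "card \<dots> \<le> card {l \<in> set ls. lit_var l \<in> circuit_vars C} +
      card {l \<in> set ls. lit_var l \<notin> circuit_vars C}"
    by (rule card_Un_le)
  finally show ?thesis using 1 by linarith
qed

section \<open>Total correctness with time bounds\<close>

lemma reg_set_reg [simp]: "reg (set_reg x v s) = (reg s)(x := v)"
  and arr_set_reg [simp]: "arr (set_reg x v s) = arr s"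
  and reg_set_cell [simp]: "reg (set_cell a k v s) = reg s"
  and arr_set_cell [simp]: "arr (set_cell a k v s) = (arr s)(a := (arr s a)(k := v))"
  by (simp_all add: set_reg_def set_cell_def)

primrec loop_free :: "com \<Rightarrow> bool" where
  "loop_free Skip = True"
| "loop_free (Assign x e) = True"
| "loop_free (Write a e f) = True"
| "loop_free (Seq P Q) = (loop_free P \<and> loop_free Q)"
| "loop_free (Cond b P Q) = (loop_free P \<and> loop_free Q)"
| "loop_free (While b P) = False"

primrec run :: "com \<Rightarrow> state \<Rightarrow> state" where
  "run Skip s = s"
| "run (Assign x e) s = set_reg x (aval e s) s"
| "run (Write a e f) s = set_cell a (aval e s) (aval f s) s"
| "run (Seq P Q) s = run Q (run P s)"
| "run (Cond b P Q) s = (if tval b s then run P s else run Q s)"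
| "run (While b P) s = s"

text \<open>Both branches of a conditional are charged, which makes the bound independent of the
  state. The values of \<open>run\<close> and \<open>run_cost\<close> at loops are
  placeholders.\<close>

primrec run_cost :: "com \<Rightarrow> nat" where
  "run_cost Skip = 1"
| "run_cost (Assign x e) = 1 + acost e"
| "run_cost (Write a e f) = 1 + acost e + acost f"
| "run_cost (Seq P Q) = run_cost P + run_cost Q"
| "run_cost (Cond b P Q) = tcost b + run_cost P + run_cost Q"
| "run_cost (While b P) = 0"

definition halts :: "com \<Rightarrow> state \<Rightarrow> nat \<Rightarrow> (state \<Rightarrow> bool) \<Rightarrow> bool" where
  "halts P s T Q \<longleftrightarrow> (\<exists>t s'. exec P s t s' \<and> t \<le> T \<and> Q s')"

text \<open>Loop-free code can thus be verified by simplifying \<open>run\<close>, without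
  derivations of \<open>exec\<close>.\<close>

lemma halts_run: "loop_free P \<Longrightarrow> Q (run P s) \<Longrightarrow> halts P s (run_cost P) Q"
proof -
  have "loop_free P \<Longrightarrow> \<exists>t. exec P s t (run P s) \<and> t \<le> run_cost P"
  proof (induction P arbitrary: s)
    case (Seq P1 P2)
    then obtain t u where "exec P1 s t (run P1 s)" "t \<le> run_cost P1"
      "exec P2 (run P1 s) u (run P2 (run P1 s))" "u \<le> run_cost P2" by fastforce
    then show ?case by (intro exI[of _ "t + u"]) (auto intro: exec.Seq)
  next
    case (Cond b P1 P2)
    show ?case
    proof (cases "tval b s")
      case True
      obtain t where "exec P1 s t (run P1 s)" "t \<le> run_cost P1" using Cond by fastforce
      with True show ?thesis by (intro exI[of _ "tcost b + t"]) (auto intro: exec.CondTrue)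
    next
      case False
      obtain t where "exec P2 s t (run P2 s)" "t \<le> run_cost P2" using Cond by fastforce
      with False show ?thesis by (intro exI[of _ "tcost b + t"]) (auto intro: exec.CondFalse)
    qed
  qed (auto intro: exec.intros simp del: add_Suc simp: exec.Assign exec.Write)
  then show "loop_free P \<Longrightarrow> Q (run P s) \<Longrightarrow> halts P s (run_cost P) Q"
    by (auto simp: halts_def)
qed

lemma halts_mono: "halts P s T Q \<Longrightarrow> T \<le> T' \<Longrightarrow> (\<And>s'. Q s' \<Longrightarrow> Q' s') \<Longrightarrow> halts P s T' Q'"
  unfolding halts_def using le_trans by blast

lemma halts_Seq:
  "halts P s T Q \<Longrightarrow> (\<And>s'. Q s' \<Longrightarrow> halts P' s' T' R) \<Longrightarrow> halts (Seq P P') s (T + T') R"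
  unfolding halts_def by (meson add_mono exec.Seq)

lemma halts_Cond:
  assumes "tval b s \<Longrightarrow> halts P s T R" "\<not> tval b s \<Longrightarrow> halts Q s T R"
  shows "halts (Cond b P Q) s (tcost b + T) R"
  using assms unfolding halts_def by (meson add_left_mono exec.CondTrue exec.CondFalse)

text \<open>A rule for loops with a known number \<open>n\<close> of rounds; \<open>I k\<close>
  holds after \<open>k\<close> of them. The factor \<open>Suc n\<close> includes the failing test at
  the end.\<close>

lemma halts_While:
  assumes "\<And>k s. k < n \<Longrightarrow> I k s \<Longrightarrow> tval b s \<and> halts P s (T k) (I (Suc k))"
    and "\<And>s. I n s \<Longrightarrow> \<not> tval b s" and "I 0 s"
  shows "halts (While b P) s (tcost b * Suc n + (\<Sum>k<n. T k)) (I n)"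
proof -
  \<comment> \<open>\<open>d\<close> is the number of rounds still to come.\<close>
  have "halts (While b P) s (tcost b * Suc d + (\<Sum>k\<in>{n - d..<n}. T k)) (I n)"
    if "I (n - d) s" "d \<le> n" for d s
    using that
  proof (induction d arbitrary: s)
    case 0
    then show ?case unfolding halts_def using assms(2) exec.WhileFalse by fastforce
  next
    case (Suc d)
    then have k: "n - Suc d < n" "Suc (n - Suc d) = n - d" by auto
    from assms(1)[OF k(1)] Suc.prems(1) obtain t s' where s': "tval b s" "exec P s t s'"
      "t \<le> T (n - Suc d)" "I (n - d) s'" unfolding halts_def k(2) by blast
    with Suc obtain u s'' where "exec (While b P) s' u s''"
      "u \<le> tcost b * Suc d + (\<Sum>k\<in>{n - d..<n}. T k)" "I n s''" unfolding halts_def by fastforce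
    moreover have "(\<Sum>k\<in>{n - Suc d..<n}. T k) = T (n - Suc d) + (\<Sum>k\<in>{n - d..<n}. T k)"
      using k by (subst sum.atLeast_Suc_lessThan) auto
    ultimately show ?case unfolding halts_def using s'
      by (intro exI[of _ "tcost b + t + u"] exI[of _ s'']) (auto intro: exec.WhileTrue)
  qed
  from this[of n s] assms(3) show ?thesis by (simp add: lessThan_atLeast0)
qed

section \<open>The linear-time program\<close>

definition sign :: "lit \<Rightarrow> nat" where
  "sign l = (case l of Pos _ \<Rightarrow> 1 | Neg _ \<Rightarrow> 0)"

text \<open>The index of a literal in the array \<open>mark\<close>. Doubling is written as a sum,
  since the machine does not multiply.\<close>

definition code :: "lit \<Rightarrow> nat" where
  "code l = lit_var l + lit_var l + sign l"

lemma code_eq_iff: "code l = code l' \<longleftrightarrow> l = l'"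
  by (cases l; cases l') (auto simp: code_def sign_def, presburger+)

lemma code_compl: "code (compl l) = Suc (lit_var l + lit_var l) - sign l"
  by (cases l) (auto simp: code_def sign_def)

abbreviation incr :: "name \<Rightarrow> aexp \<Rightarrow> com" where
  "incr x e \<equiv> Assign x (Plus (Reg x) e)"

abbreviation "ri \<equiv> Reg (Work ''i'')"
abbreviation "rj \<equiv> Reg (Work ''j'')"
abbreviation "rfree \<equiv> Reg (Work ''free'')"
abbreviation "rn \<equiv> Reg (In ''nodes'')"

definition mark_body :: com where
  "mark_body = Seq
     (Write (Work ''mark'')
       (Plus (Plus (Cell (In ''lit_var'') ri) (Cell (In ''lit_var'') ri)) (Cell (In ''lit_sign'') ri))
       (Num 1))
     (incr (Work ''i'') (Num 1))"

definition mark_lits :: com where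
  "mark_lits = Seq (Assign (Work ''i'') (Num 0)) (While (Less ri (Reg (In ''lits''))) mark_body)"

text \<open>The cells of the output array \<open>child\<close> below \<open>2 * n + 1\<close> are filled with the identity: they are
  the child list of the tautology that makes all gates reachable.\<close>

definition node_init :: com where
  "node_init =
     Seq (Write (Out ''child'') ri ri)
    (Seq (Write (Out ''child'') (Plus rn ri) (Plus rn ri))
    (Seq (Write (Out ''kind'') (Plus rn ri) (Num 0))
         (Write (Out ''fst'') (Plus rn ri) (Num 0))))"

text \<open>The record is copied first and then overwritten by the constant false if it is a literal
  whose complement is marked. The index tested is the one given by
  \<open>code_compl\<close>.\<close>

definition leaf_node :: com where
  "leaf_node =
     Seq (Write (Out ''kind'') ri (Cell (In ''kind'') ri))
    (Seq (Write (Out ''fst'') ri (Cell (In ''fst'') ri))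
    (Seq (Write (Out ''snd'') ri (Cell (In ''snd'') ri))
         (Cond (Equal (Cell (In ''kind'') ri) (Num 1))
           (Cond (Equal (Cell (Work ''mark'')
                    (Minus (Plus (Num 1) (Plus (Cell (In ''snd'') ri) (Cell (In ''snd'') ri)))
                       (Cell (In ''fst'') ri))) (Num 1))
             (Seq (Write (Out ''kind'') ri (Num 0)) (Write (Out ''fst'') ri (Num 0)))
             Skip)
           Skip)))"

definition inner_head :: com where
  "inner_head =
     Seq (Write (Out ''kind'') ri (Cell (In ''kind'') ri))
    (Seq (Write (Out ''fst'') ri rfree)
         (Assign (Work ''j'') (Num 0)))"

definition copy_body :: com where
  "copy_body = Seq
     (Write (Out ''child'') (Plus rfree rj) (Cell (In ''child'') (Plus (Cell (In ''fst'') ri) rj)))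
     (incr (Work ''j'') (Num 1))"

definition copy_test :: test where
  "copy_test = Less rj (Cell (In ''snd'') ri)"

text \<open>With truncated subtraction one of the two summands is zero, and the sum is the absolute
  difference.\<close>

abbreviation dist :: "aexp \<Rightarrow> aexp \<Rightarrow> aexp" where
  "dist e f \<equiv> Plus (Minus e f) (Minus f e)"

text \<open>A sum of naturals vanishes iff all summands do, so one test expresses a conjunction of
  equations; the last one says that the two signs differ.\<close>

definition opposite_test :: "aexp \<Rightarrow> aexp \<Rightarrow> test" where
  "opposite_test x y = Equal
     (Plus (Plus (dist (Cell (In ''kind'') x) (Num 1)) (dist (Cell (In ''kind'') y) (Num 1)))
       (Plus (dist (Cell (In ''snd'') x) (Cell (In ''snd'') y))
         (dist (Plus (Cell (In ''fst'') x) (Cell (In ''fst'') y)) (Num 1))))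
     (Num 0)"

definition write_pair :: "string \<Rightarrow> string \<Rightarrow> com" where
  "write_pair x y =
     Seq (Write (Out ''child'') rfree (Reg (Work x)))
         (Write (Out ''child'') (Plus rfree (Num 1)) (Reg (Work y)))"

definition choose_pair :: com where
  "choose_pair =
     Cond (opposite_test (Reg (Work ''c0'')) (Reg (Work ''d0''))) (write_pair ''c1'' ''d1'')
    (Cond (opposite_test (Reg (Work ''c0'')) (Reg (Work ''d1''))) (write_pair ''c1'' ''d0'')
    (Cond (opposite_test (Reg (Work ''c1'')) (Reg (Work ''d0''))) (write_pair ''c0'' ''d1'')
          (write_pair ''c0'' ''d0'')))"

text \<open>The resolvent becomes the third child of the or-node, right behind the two copied ones.
  The registers \<open>p\<close> and \<open>q\<close> receive the positions of the child lists of
  the two branches, not the branches themselves.\<close>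

definition resolve_head :: com where
  "resolve_head =
     Seq (Write (Out ''child'') rfree (Plus rn ri))
    (Seq (Write (Out ''snd'') ri (Num 3))
    (Seq (incr (Work ''free'') (Num 1))
    (Seq (Write (Out ''kind'') (Plus rn ri) (Num 2))
    (Seq (Write (Out ''fst'') (Plus rn ri) rfree)
    (Seq (Write (Out ''snd'') (Plus rn ri) (Num 2))
    (Seq (Assign (Work ''p'') (Cell (In ''fst'') (Cell (In ''child'') (Cell (In ''fst'') ri))))
    (Seq (Assign (Work ''q'') (Cell (In ''fst'') (Cell (In ''child'') (Plus (Cell (In ''fst'') ri) (Num 1)))))
    (Seq (Assign (Work ''c0'') (Cell (In ''child'') (Reg (Work ''p''))))
    (Seq (Assign (Work ''c1'') (Cell (In ''child'') (Plus (Reg (Work ''p'')) (Num 1))))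
    (Seq (Assign (Work ''d0'') (Cell (In ''child'') (Reg (Work ''q''))))
         (Assign (Work ''d1'') (Cell (In ''child'') (Plus (Reg (Work ''q'')) (Num 1))))))))))))))"

definition resolve :: com where
  "resolve = Seq resolve_head (Seq choose_pair (incr (Work ''free'') (Num 2)))"

definition inner_tail :: com where
  "inner_tail =
     Seq (incr (Work ''free'') rj)
    (Seq (Write (Out ''snd'') ri rj)
         (Cond (Equal (Cell (In ''kind'') ri) (Num 3)) resolve Skip))"

definition next_node :: com where
  "next_node = incr (Work ''i'') (Num 1)"

definition node_body :: com where
  "node_body =
     Seq node_init
    (Seq (Cond (Less (Cell (In ''kind'') ri) (Num 2)) leaf_node
           (Seq inner_head (Seq (While copy_test copy_body) inner_tail)))
         next_node)"

definition nodes_init :: com where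
  "nodes_init =
     Seq (Assign (Work ''i'') (Num 0))
         (Assign (Work ''free'') (Plus (Plus rn rn) (Num 1)))"

text \<open>The tautology takes the identity cells from position 0 as its child list, so nothing is
  copied; only cell \<open>2 * n\<close> has yet to be filled.\<close>

definition finish :: com where
  "finish =
     Seq (Assign (Work ''i'') (Plus rn rn))
    (Seq (Write (Out ''kind'') ri (Num 0))
    (Seq (Write (Out ''fst'') ri (Num 1))
    (Seq (Write (Out ''child'') ri ri)
    (Seq (incr (Work ''i'') (Num 1))
    (Seq (Write (Out ''kind'') ri (Num 3))
    (Seq (Write (Out ''fst'') ri (Num 0))
    (Seq (Write (Out ''snd'') ri ri)
    (Seq (Write (Out ''child'') rfree (Reg (In ''root'')))
    (Seq (Write (Out ''child'') (Plus rfree (Num 1)) ri)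
    (Seq (incr (Work ''i'') (Num 1))
    (Seq (Write (Out ''kind'') ri (Num 2))
    (Seq (Write (Out ''fst'') ri rfree)
    (Seq (Write (Out ''snd'') ri (Num 2))
    (Seq (Assign (Out ''root'') ri)
         (Assign (Out ''nodes'') (Plus ri (Num 1)))))))))))))))))"

definition quantify :: com where
  "quantify = Seq mark_lits
    (Seq nodes_init (Seq (While (Less ri rn) node_body) finish))"

section \<open>Marking the literals and testing for complementary leaves\<close>

lemma stores_gate_cong:
  assumes "\<And>a. arr s' (io a) = arr s (io a)"
  shows "stores_gate io s' i g = stores_gate io s i g"
  by (cases g) (simp_all add: assms)

lemma stores_circuit_cong:
  assumes "\<And>a. arr s' (io a) = arr s (io a)" "\<And>a. reg s' (io a) = reg s (io a)"
  shows "stores_circuit io s' C = stores_circuit io s C"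
  by (simp add: stores_circuit_def assms stores_gate_cong[OF assms(1)])

lemma stores_circuit_update [simp]:
  "stores_circuit In (set_reg (Work x) v s) C = stores_circuit In s C"
  "stores_circuit In (set_reg (Out x) v s) C = stores_circuit In s C"
  "stores_circuit In (set_cell (Work x) k v s) C = stores_circuit In s C"
  "stores_circuit In (set_cell (Out x) k v s) C = stores_circuit In s C"
  by (rule stores_circuit_cong; simp)+

definition marked :: "state \<Rightarrow> lit set \<Rightarrow> bool" where
  "marked s S \<longleftrightarrow> (\<forall>l. arr s (Work ''mark'') (code l) = of_bool (l \<in> S))"

text \<open>After \<open>k\<close> rounds exactly the first \<open>k\<close> literals are marked.
  Zeroed working arrays give the case \<open>k = 0\<close>, and injectivity of \<open>code\<close>
  protects the other marks.\<close>

lemma halts_mark_lits: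
  assumes inp: "stores_circuit In s C" "stores_lits In s ls" "\<And>a k. arr s (Work a) k = 0"
  shows "halts mark_lits s
    (2 + (tcost (Less ri (Reg (In ''lits''))) + run_cost mark_body) * (length ls + 1))
    (\<lambda>s'. stores_circuit In s' C \<and> marked s' (set ls))"
proof -
  let ?I = "\<lambda>k s'. stores_circuit In s' C \<and> stores_lits In s' ls \<and> reg s' (Work ''i'') = k \<and>
    marked s' (set (take k ls))"
  have 1: "halts (While (Less ri (Reg (In ''lits''))) mark_body) (set_reg (Work ''i'') 0 s)
     (tcost (Less ri (Reg (In ''lits''))) * Suc (length ls) + (\<Sum>k<length ls. run_cost mark_body))
     (?I (length ls))"
  proof (rule halts_While)
    show "?I 0 (set_reg (Work ''i'') 0 s)"
      using inp by (simp add: stores_lits_def marked_def)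
    fix k s' assume k: "k < length ls" and I: "?I k s'"
    have v: "arr s' (In ''lit_var'') k = lit_var (ls ! k)" "arr s' (In ''lit_sign'') k = sign (ls ! k)"
      and n: "reg s' (In ''lits'') = length ls"
      using I k by (auto simp: stores_lits_def sign_def)
    have "?I (Suc k) (run mark_body s')"
      using I k by (simp add: mark_body_def v code_def[symmetric] stores_lits_def marked_def take_Suc_conv_app_nth code_eq_iff)
    then have "halts mark_body s' (run_cost mark_body) (?I (Suc k))"
      by (rule halts_run[rotated]) (simp add: mark_body_def)
    then show "tval (Less ri (Reg (In ''lits''))) s' \<and> halts mark_body s' (run_cost mark_body) (?I (Suc k))"
      using I k n by simp
  qed (simp add: stores_lits_def)
  have "halts mark_lits s (run_cost (Assign (Work ''i'') (Num 0)) +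
     (tcost (Less ri (Reg (In ''lits''))) * Suc (length ls) + (\<Sum>k<length ls. run_cost mark_body)))
     (?I (length ls))"
    unfolding mark_lits_def
    by (rule halts_Seq[OF halts_run[where Q = "\<lambda>s'. s' = set_reg (Work ''i'') 0 s"]])
      (use 1 in simp_all)
  then show ?thesis
    by (rule halts_mono) (simp_all add: algebra_simps)
qed

text \<open>The \<open>kind\<close> equations come first because \<open>fst\<close> and
  \<open>snd\<close> mean something else at other gates. For two literals, signs with sum 1 are
  opposite signs.\<close>

lemma tval_opposite_test:
  assumes C: "stores_circuit In s C" and "aval x s < length (gates C)" "aval y s < length (gates C)"
  shows "tval (opposite_test x y) s \<longleftrightarrow> opposite C (aval x s) (aval y s)"
proof -
  have d: "((a - 1) + (1 - a)) + ((b - 1) + (1 - b)) + (((c - d) + (d - c)) + ((e - 1) + (1 - e))) = 0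
      \<longleftrightarrow> a = 1 \<and> b = 1 \<and> c = d \<and> e = 1" for a b c d e :: nat by auto
  have st: "stores_gate In s (aval x s) (gates C ! aval x s)"
    "stores_gate In s (aval y s) (gates C ! aval y s)"
    using assms by (auto simp: stores_circuit_def)
  have t: "tval (opposite_test x y) s \<longleftrightarrow>
    arr s (In ''kind'') (aval x s) = 1 \<and> arr s (In ''kind'') (aval y s) = 1 \<and>
    arr s (In ''snd'') (aval x s) = arr s (In ''snd'') (aval y s) \<and>
    arr s (In ''fst'') (aval x s) + arr s (In ''fst'') (aval y s) = 1"
    unfolding opposite_test_def tval.simps aval.simps by (rule d)
  show ?thesis
  proof (cases "\<exists>l l'. gates C ! aval x s = Lit l \<and> gates C ! aval y s = Lit l'")
    case True
    then obtain l l' where l: "gates C ! aval x s = Lit l" "gates C ! aval y s = Lit l'" by blast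
    with st show ?thesis unfolding t opposite_def by (cases l; cases l') auto
  next
    case False
    then have "arr s (In ''kind'') (aval x s) \<noteq> 1 \<or> arr s (In ''kind'') (aval y s) \<noteq> 1"
      using st by (cases "gates C ! aval x s"; cases "gates C ! aval y s") auto
    with False show ?thesis unfolding t opposite_def by auto
  qed
qed

section \<open>Processing a single node\<close>

lemma marked_update [simp]:
  "marked (set_reg x v s) S = marked s S"
  "marked (set_cell (Out y) k v s) S = marked s S"
  by (simp_all add: marked_def)

text \<open>A closed form of the state after \<open>m\<close> rounds of copying, so that the loop
  invariant is an equation between states.\<close>

definition copied :: "state \<Rightarrow> nat \<Rightarrow> state" where
  "copied s m = State ((reg s)(Work ''j'' := m)) ((arr s)(Out ''child'' :=
     (\<lambda>k. if reg s (Work ''free'') \<le> k \<and> k < reg s (Work ''free'') + m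
          then arr s (In ''child'') (arr s (In ''fst'') (reg s (Work ''i'')) + (k - reg s (Work ''free'')))
          else arr s (Out ''child'') k)))"

lemma halts_copy:
  assumes "reg s (Work ''j'') = 0" "arr s (In ''snd'') (reg s (Work ''i'')) = m"
  shows "halts (While copy_test copy_body) s (tcost copy_test * Suc m + (\<Sum>k<m. run_cost copy_body))
    (\<lambda>s'. s' = copied s m)"
proof (rule halts_While)
  show "s = copied s 0"
    using assms(1) by (cases s) (auto simp: copied_def fun_eq_iff)
  fix k s' assume k: "k < m" and s': "s' = copied s k"
  have "run copy_body s' = copied s (Suc k)"
    by (auto simp: s' copy_body_def copied_def set_reg_def set_cell_def fun_eq_iff)
  then have "halts copy_body s' (run_cost copy_body) (\<lambda>s'. s' = copied s (Suc k))"
    by (intro halts_run) (simp_all add: copy_body_def)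
  then show "tval copy_test s' \<and> halts copy_body s' (run_cost copy_body) (\<lambda>s'. s' = copied s (Suc k))"
    using k assms(2) by (simp add: copy_test_def s' copied_def)
qed (use assms(2) in \<open>simp add: copy_test_def copied_def\<close>)

text \<open>The bounds confine the child list to the cells from \<open>b\<close> up to but excluding
  \<open>f\<close>. Writes outside this region and outside record \<open>j\<close> then cannot
  damage the gate, which is \<open>placed_frame\<close>.\<close>

definition placed :: "state \<Rightarrow> nat \<Rightarrow> nat \<Rightarrow> nat \<Rightarrow> gate \<Rightarrow> bool" where
  "placed s b f j g \<longleftrightarrow> stores_gate Out s j g \<and>
     (children g \<noteq> [] \<longrightarrow> b \<le> arr s (Out ''fst'') j \<and> arr s (Out ''fst'') j + length (children g) \<le> f)"

lemma placed_frame: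
  assumes "placed s b f j g" "f \<le> f'"
    and "\<And>a. a \<noteq> ''child'' \<Longrightarrow> arr s' (Out a) j = arr s (Out a) j"
    and "\<And>k. b \<le> k \<Longrightarrow> k < f \<Longrightarrow> arr s' (Out ''child'') k = arr s (Out ''child'') k"
  shows "placed s' b f' j g"
proof -
  have [simp]: "arr s' (Out ''kind'') j = arr s (Out ''kind'') j"
    "arr s' (Out ''fst'') j = arr s (Out ''fst'') j" "arr s' (Out ''snd'') j = arr s (Out ''snd'') j"
    by (simp_all add: assms(3))
  show ?thesis using assms(1,2,4) by (cases g) (fastforce simp: placed_def)+
qed

lemma run_choose_pair:
  assumes "stores_circuit In s C"
    and "gates C ! p = And [c0, c1]" "gates C ! q = And [d0, d1]"
    and "c0 < length (gates C)" "c1 < length (gates C)" "d0 < length (gates C)" "d1 < length (gates C)"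
    and "reg s (Work ''c0'') = c0" "reg s (Work ''c1'') = c1"
    and "reg s (Work ''d0'') = d0" "reg s (Work ''d1'') = d1"
  obtains a b where "resolvent C p q = [a, b]"
    "run choose_pair s = set_cell (Out ''child'') (Suc (reg s (Work ''free''))) b
       (set_cell (Out ''child'') (reg s (Work ''free'')) a s)"
proof -
  note simps = choose_pair_def write_pair_def tval_opposite_test[OF assms(1)] assms(2-) resolvent_def Let_def
  consider "opposite C c0 d0" | "\<not> opposite C c0 d0" "opposite C c0 d1"
    | "\<not> opposite C c0 d0" "\<not> opposite C c0 d1" "opposite C c1 d0"
    | "\<not> opposite C c0 d0" "\<not> opposite C c0 d1" "\<not> opposite C c1 d0"
    by blast
  then show ?thesis
  proof cases
    case 1
    then show ?thesis by (intro that[of c1 d1]) (simp_all add: simps)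
  next
    case 2
    then show ?thesis by (intro that[of c1 d0]) (simp_all add: simps)
  next
    case 3
    then show ?thesis by (intro that[of c0 d1]) (simp_all add: simps)
  next
    case 4
    then show ?thesis by (intro that[of c0 d0]) (simp_all add: simps)
  qed
qed

text \<open>The contract of one round. Its frame conditions exempt the records \<open>i\<close> and
  \<open>n + i\<close>, the identity cells of the same numbers, and the cells of
  \<open>child\<close> that were still free.\<close>

definition node_done :: "circuit \<Rightarrow> lit set \<Rightarrow> nat \<Rightarrow> state \<Rightarrow> state \<Rightarrow> bool" where
  "node_done C S i s s' \<longleftrightarrow> (let n = length (gates C) in
     stores_circuit In s' C \<and> marked s' S \<and> reg s' (Work ''i'') = Suc i \<and>
     reg s (Work ''free'') \<le> reg s' (Work ''free'') \<and>
     (\<forall>a j. a \<noteq> ''child'' \<and> j \<noteq> i \<and> j \<noteq> n + i \<longrightarrow> arr s' (Out a) j = arr s (Out a) j) \<and>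
     (\<forall>k < reg s (Work ''free''). k \<noteq> i \<and> k \<noteq> n + i \<longrightarrow>
        arr s' (Out ''child'') k = arr s (Out ''child'') k) \<and>
     arr s' (Out ''child'') i = i \<and> arr s' (Out ''child'') (n + i) = n + i \<and>
     placed s' (2 * n + 1) (reg s' (Work ''free'')) i (main_gate C S i) \<and>
     placed s' (2 * n + 1) (reg s' (Work ''free'')) (n + i) (aux_gate C i))"

lemma node_done_leaf:
  assumes inp: "stores_circuit In s C" "marked s S"
    and i: "i < length (gates C)" "reg s (Work ''i'') = i"
    and leaf: "arr s (In ''kind'') i < 2"
  shows "node_done C S i s (run next_node (run leaf_node (run node_init s)))"
proof -
  have n: "reg s (In ''nodes'') = length (gates C)" and g: "stores_gate In s i (gates C ! i)"
    using inp(1) i(1) by (auto simp: stores_circuit_def)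
  show ?thesis
  proof (cases "gates C ! i")
    case (Const b)
    then show ?thesis using g inp i
      by (auto simp: node_done_def Let_def next_node_def leaf_node_def node_init_def n placed_def
          main_gate_def aux_gate_def)
  next
    case (Lit l)
    \<comment> \<open>The mark of \<open>compl l\<close>, at the index in the form in which the
      program computes it.\<close>
    have "arr s (Work ''mark'') (Suc (lit_var l + lit_var l) - sign l) = of_bool (compl l \<in> S)"
      using inp(2) unfolding marked_def code_compl[symmetric] by blast
    with Lit show ?thesis using g inp i unfolding sign_def
      by (cases l) (auto simp: node_done_def Let_def next_node_def leaf_node_def node_init_def n placed_def
          main_gate_def aux_gate_def)
  qed (use g leaf in auto)
qed

text \<open>The run is cut at intermediate states with explicit descriptions: \<open>t\<close> after
  the copying and, for an or-node, \<open>u\<close> just before the pair is chosen.\<close>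

lemma node_done_inner:
  assumes C: "decision_dnnf C" and inp: "stores_circuit In s C" "marked s S"
    and i: "i < length (gates C)" "reg s (Work ''i'') = i"
    and f: "2 * length (gates C) + 1 \<le> reg s (Work ''free'')"
    and js: "gates C ! i = And js \<or> gates C ! i = Or js"
  shows "node_done C S i s (run next_node (run inner_tail
    (copied (run inner_head (run node_init s)) (length js))))"
proof -
  define f0 where "f0 = reg s (Work ''free'')"
  define t where "t = copied (run inner_head (run node_init s)) (length js)"
  let ?n = "length (gates C)"
  have nnf: "nnf_circuit C" using C by (simp add: decision_dnnf_def)
  have n: "reg s (In ''nodes'') = ?n" and stored: "\<And>j. j < ?n \<Longrightarrow> stores_gate In s j (gates C ! j)"
    using inp(1) by (auto simp: stores_circuit_def)
  note g = stored[OF i(1)]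
  note defs = t_def copied_def inner_head_def node_init_def
  have t_inp: "stores_circuit In t C" "marked t S"
    using inp by (simp_all add: defs stores_circuit_def marked_def stores_gate_cong[where s' = "State _ _" and s = s])
  have t_reg: "reg t = (reg s)(Work ''j'' := length js)"
    by (auto simp: defs fun_eq_iff)
  have t_in: "arr t (In a) = arr s (In a)" for a
    by (simp add: defs)
  have t_kind: "arr t (Out ''kind'') = (arr s (Out ''kind''))(?n + i := 0, i := arr s (In ''kind'') i)"
    using i n by (auto simp: defs)
  have t_fst: "arr t (Out ''fst'') = (arr s (Out ''fst''))(?n + i := 0, i := f0)"
    using i n by (auto simp: defs f0_def)
  have t_other: "a \<noteq> ''child'' \<Longrightarrow> j \<noteq> i \<Longrightarrow> j \<noteq> ?n + i \<Longrightarrow> arr t (Out a) j = arr s (Out a) j" for a j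
    using i n by (auto simp: defs)
  have t_child: "arr t (Out ''child'') = (\<lambda>k. if f0 \<le> k \<and> k < f0 + length js then js ! (k - f0)
      else if k = i then i else if k = ?n + i then ?n + i else arr s (Out ''child'') k)"
  proof
    fix k
    have "\<forall>k < length js. arr s (In ''child'') (arr s (In ''fst'') i + k) = js ! k"
      using g js by auto
    from this[rule_format, of "k - f0"]
    show "arr t (Out ''child'') k = (if f0 \<le> k \<and> k < f0 + length js then js ! (k - f0)
      else if k = i then i else if k = ?n + i then ?n + i else arr s (Out ''child'') k)"
      using i n by (auto simp: defs f0_def)
  qed
  have f0: "2 * ?n + 1 \<le> f0" using f by (simp add: f0_def)
  have t_free: "reg s (Work ''free'') = f0" by (simp add: f0_def)
  note t = t_inp t_reg t_in t_kind t_fst t_other t_child t_free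
  have "node_done C S i s (run next_node (run inner_tail t))"
    using js
  proof
    assume And: "gates C ! i = And js"
    then show ?thesis using g i n f0
      by (auto simp: node_done_def Let_def inner_tail_def next_node_def t placed_def
          main_gate_def aux_gate_def)
  next
    assume Or: "gates C ! i = Or js"
    obtain p q l a b where pq: "js = [p, q]" "lit_conj C p l a" "lit_conj C q (compl l) b"
      using decision_resolvent[OF C i(1) Or] .
    from pq obtain c0 c1 d0 d1 where gp: "gates C ! p = And [c0, c1]" and gq: "gates C ! q = And [d0, d1]"
      by (auto simp: lit_conj_def)
    have "p < ?n" "q < ?n" using child_bound[OF nnf i(1)] Or pq(1) by auto
    note p = stored[OF this(1), unfolded gp] and q = stored[OF this(2), unfolded gq]
    have bound: "c0 < ?n" "c1 < ?n" "d0 < ?n" "d1 < ?n"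
      using child_bound[OF nnf \<open>p < ?n\<close>] child_bound[OF nnf \<open>q < ?n\<close>] gp gq by auto
    have In: "arr s (In ''kind'') i = 3" "arr s (In ''child'') (arr s (In ''fst'') i) = p"
      "arr s (In ''child'') (Suc (arr s (In ''fst'') i)) = q"
      "arr s (In ''child'') (arr s (In ''fst'') p) = c0" "arr s (In ''child'') (Suc (arr s (In ''fst'') p)) = c1"
      "arr s (In ''child'') (arr s (In ''fst'') q) = d0" "arr s (In ''child'') (Suc (arr s (In ''fst'') q)) = d1"
      using g p q by (auto simp: Or pq(1) All_less_Suc)
    \<comment> \<open>The cells \<open>f0\<close> and \<open>f0 + 1\<close> hold the copied children
      and \<open>f0 + 2\<close> will hold the resolvent, so the pair starts at
      \<open>f0 + 3\<close>.\<close>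
    define u where "u = run resolve_head (set_cell (Out ''snd'') i (Suc (Suc 0)) (set_reg (Work ''free'') (f0 + 2) t))"
    have tail: "run inner_tail t = run (Seq choose_pair (incr (Work ''free'') (Num 2))) u"
      using i by (simp add: u_def inner_tail_def resolve_def t In pq(1))
    have u_inp: "stores_circuit In u C" "marked u S"
      by (simp_all add: u_def resolve_head_def t_inp)
    have u_reg: "reg u (Work ''c0'') = c0" "reg u (Work ''c1'') = c1" "reg u (Work ''d0'') = d0"
      "reg u (Work ''d1'') = d1" "reg u (Work ''i'') = i" "reg u (Work ''free'') = f0 + 3"
      using i by (simp_all add: u_def resolve_head_def t In)
    have u_kind: "arr u (Out ''kind'') = (arr s (Out ''kind''))(?n + i := 2, i := 3)"
      using i n by (auto simp: u_def resolve_head_def t In fun_eq_iff)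
    have u_fst: "arr u (Out ''fst'') = (arr s (Out ''fst''))(?n + i := f0 + 3, i := f0)"
      using i n by (auto simp: u_def resolve_head_def t fun_eq_iff)
    have u_snd: "arr u (Out ''snd'') i = 3" "arr u (Out ''snd'') (?n + i) = 2"
      using i n by (auto simp: u_def resolve_head_def t)
    have u_other: "a \<noteq> ''child'' \<Longrightarrow> j \<noteq> i \<Longrightarrow> j \<noteq> ?n + i \<Longrightarrow> arr u (Out a) j = arr s (Out a) j" for a j
      using i n by (auto simp: u_def resolve_head_def t)
    have u_child: "arr u (Out ''child'') = (arr t (Out ''child''))(f0 + 2 := ?n + i)"
      using i n by (auto simp: u_def resolve_head_def t)
    have t_list: "arr t (Out ''child'') f0 = p" "arr t (Out ''child'') (Suc f0) = q"
      by (simp_all add: t_child pq(1))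
    have t_low: "arr t (Out ''child'') k = (if k = i then i else if k = ?n + i then ?n + i
        else arr s (Out ''child'') k)" if "k < f0" for k
      using that by (simp add: t_child)
    \<comment> \<open>From here on \<open>a\<close> and \<open>b\<close> are the pair that the
      program writes, shadowing the earlier names.\<close>
    obtain a b where ab: "resolvent C p q = [a, b]"
      "run choose_pair u = set_cell (Out ''child'') (Suc (f0 + 3)) b (set_cell (Out ''child'') (f0 + 3) a u)"
      using run_choose_pair[OF u_inp(1) gp gq bound u_reg(1-4)] unfolding u_reg by blast
    have main: "main_gate C S i = Or [p, q, ?n + i]" and aux: "aux_gate C i = And [a, b]"
      by (simp_all add: main_gate_def aux_gate_def Or pq(1) ab(1))
    \<comment> \<open>This keeps the records \<open>i\<close> and \<open>?n + i\<close>
      apart.\<close>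
    have "gates C \<noteq> []" using i by auto
    then show ?thesis unfolding tail using i n f0
      by (simp add: main aux node_done_def Let_def next_node_def ab(2) u_inp u_reg u_kind u_fst u_snd u_other
          u_child t_list t_low t_free placed_def numeral_3_eq_3 numeral_2_eq_2 All_less_Suc)
  qed
  then show ?thesis by (simp add: t_def)
qed

text \<open>The share of a round that does not grow with the number of children. It pays for leaves
  and inner nodes alike, and for the test that ends the copying.\<close>

definition node_cost :: nat where
  "node_cost = run_cost node_init + (tcost (Less (Cell (In ''kind'') ri) (Num 2)) +
     (run_cost leaf_node + run_cost inner_head + tcost copy_test + run_cost inner_tail)) +
     run_cost next_node"

definition copy_cost :: nat where
  "copy_cost = tcost copy_test + run_cost copy_body"

lemma loop_free_parts:
  "loop_free node_init" "loop_free leaf_node" "loop_free inner_head" "loop_free inner_tail"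
  "loop_free next_node" "loop_free nodes_init" "loop_free finish"
  by (simp_all add: node_init_def leaf_node_def inner_head_def inner_tail_def resolve_def
      resolve_head_def choose_pair_def write_pair_def next_node_def nodes_init_def finish_def)

lemma halts_node_body:
  assumes C: "decision_dnnf C" and inp: "stores_circuit In s C" "marked s S"
    and i: "i < length (gates C)" "reg s (Work ''i'') = i"
    and f: "2 * length (gates C) + 1 \<le> reg s (Work ''free'')"
  shows "halts node_body s (node_cost + copy_cost * length (children (gates C ! i))) (node_done C S i s)"
proof -
  let ?s = "run node_init s"
  let ?m = "length (children (gates C ! i))"
  let ?b = "Less (Cell (In ''kind'') ri) (Num 2)"
  let ?T = "run_cost leaf_node + run_cost inner_head + tcost copy_test + run_cost inner_tail + copy_cost * ?m"
  \<comment> \<open>The contract holds only once \<open>i\<close> has been incremented, so it is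
    pulled back through \<open>next_node\<close>.\<close>
  let ?Q = "\<lambda>s'. node_done C S i s (run next_node s')"
  have g: "stores_gate In s i (gates C ! i)"
    using inp(1) i(1) by (auto simp: stores_circuit_def)
  have kind: "tval ?b ?s \<longleftrightarrow> arr s (In ''kind'') i < 2"
    using i by (simp add: node_init_def)
  have cond: "halts (Cond ?b leaf_node (Seq inner_head (Seq (While copy_test copy_body) inner_tail))) ?s
      (tcost ?b + ?T) ?Q"
  proof (rule halts_Cond)
    assume "tval ?b ?s"
    then have "?Q (run leaf_node ?s)" using node_done_leaf[OF inp i] kind by simp
    from halts_run[where Q = ?Q, OF loop_free_parts(2) this] show "halts leaf_node ?s ?T ?Q"
      by (rule halts_mono) simp_all
  next
    assume "\<not> tval ?b ?s"
    then have "\<not> arr s (In ''kind'') i < 2" using kind by simp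
    with g obtain js where js: "gates C ! i = And js \<or> gates C ! i = Or js"
      by (cases "gates C ! i") auto
    let ?h = "run inner_head ?s"
    have head: "reg ?h (Work ''j'') = 0" "arr ?h (In ''snd'') (reg ?h (Work ''i'')) = ?m"
      using g js i by (auto simp: inner_head_def node_init_def)
    have m: "?m = length js" using js by auto
    have "halts (Seq inner_head (Seq (While copy_test copy_body) inner_tail)) ?s
      (run_cost inner_head + ((tcost copy_test * Suc ?m + (\<Sum>k<?m. run_cost copy_body)) + run_cost inner_tail)) ?Q"
    proof (rule halts_Seq)
      show "halts inner_head ?s (run_cost inner_head) (\<lambda>s'. s' = ?h)"
        by (rule halts_run[OF loop_free_parts(3)]) simp
      fix s' assume s': "s' = ?h"
      show "halts (Seq (While copy_test copy_body) inner_tail) s'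
        ((tcost copy_test * Suc ?m + (\<Sum>k<?m. run_cost copy_body)) + run_cost inner_tail) ?Q"
        unfolding s'
      proof (rule halts_Seq[OF halts_copy[OF head]])
        fix s'' assume "s'' = copied ?h ?m"
        then have "?Q (run inner_tail s'')"
          using node_done_inner[OF C inp i f js] m by simp
        then show "halts inner_tail s'' (run_cost inner_tail) ?Q"
          by (intro halts_run[OF loop_free_parts(4)])
      qed
    qed
    then show "halts (Seq inner_head (Seq (While copy_test copy_body) inner_tail)) ?s ?T ?Q"
      by (rule halts_mono) (simp_all add: copy_cost_def algebra_simps)
  qed
  have "halts node_body s (run_cost node_init + ((tcost ?b + ?T) + run_cost next_node)) (node_done C S i s)"
    unfolding node_body_def
  proof (rule halts_Seq)
    show "halts node_init s (run_cost node_init) (\<lambda>s'. s' = ?s)"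
      by (rule halts_run[OF loop_free_parts(1)]) simp
    fix s' assume "s' = ?s"
    with cond have c: "halts (Cond ?b leaf_node (Seq inner_head (Seq (While copy_test copy_body) inner_tail))) s'
      (tcost ?b + ?T) ?Q" by simp
    show "halts (Seq (Cond ?b leaf_node (Seq inner_head (Seq (While copy_test copy_body) inner_tail)))
      next_node) s' ((tcost ?b + ?T) + run_cost next_node) (node_done C S i s)"
      by (rule halts_Seq[OF c]) (rule halts_run[OF loop_free_parts(5)])
  qed
  then show ?thesis by (rule halts_mono) (simp_all add: node_cost_def)
qed

section \<open>The loop over all nodes, the last three gates and the total time\<close>

definition nodes_inv :: "circuit \<Rightarrow> lit set \<Rightarrow> nat \<Rightarrow> state \<Rightarrow> bool" where
  "nodes_inv C S i s \<longleftrightarrow> (let n = length (gates C) in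
     stores_circuit In s C \<and> marked s S \<and> reg s (Work ''i'') = i \<and> 2 * n + 1 \<le> reg s (Work ''free'') \<and>
     (\<forall>j < i. arr s (Out ''child'') j = j \<and> arr s (Out ''child'') (n + j) = n + j \<and>
        placed s (2 * n + 1) (reg s (Work ''free'')) j (main_gate C S j) \<and>
        placed s (2 * n + 1) (reg s (Work ''free'')) (n + j) (aux_gate C j)))"

text \<open>Nodes finished earlier survive by the frame conditions: for \<open>j < i < n\<close> the
  numbers \<open>j\<close> and \<open>n + j\<close> both differ from \<open>i\<close> and
  \<open>n + i\<close>.\<close>

lemma nodes_inv_step:
  assumes inv: "nodes_inv C S i s" and i: "i < length (gates C)" and nd: "node_done C S i s s'"
  shows "nodes_inv C S (Suc i) s'"
proof -
  let ?n = "length (gates C)"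
  have free: "2 * ?n + 1 \<le> reg s (Work ''free'')" using inv by (simp add: nodes_inv_def Let_def)
  note d = nd[unfolded node_done_def Let_def]
  have "arr s' (Out ''child'') j = j \<and> arr s' (Out ''child'') (?n + j) = ?n + j \<and>
        placed s' (2 * ?n + 1) (reg s' (Work ''free'')) j (main_gate C S j) \<and>
        placed s' (2 * ?n + 1) (reg s' (Work ''free'')) (?n + j) (aux_gate C j)" if "j < Suc i" for j
  proof (cases "j = i")
    case True
    then show ?thesis using d by simp
  next
    case False
    with that have j: "j < i" by simp
    have old: "arr s (Out ''child'') j = j" "arr s (Out ''child'') (?n + j) = ?n + j"
      "placed s (2 * ?n + 1) (reg s (Work ''free'')) j (main_gate C S j)"
      "placed s (2 * ?n + 1) (reg s (Work ''free'')) (?n + j) (aux_gate C j)"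
      using inv j by (auto simp: nodes_inv_def Let_def)
    have "arr s' (Out ''child'') j = j" "arr s' (Out ''child'') (?n + j) = ?n + j"
      using d free i j old(1,2) by auto
    moreover have "placed s' (2 * ?n + 1) (reg s' (Work ''free'')) j (main_gate C S j)"
      using old(3) by (rule placed_frame) (use d i j in auto)
    moreover have "placed s' (2 * ?n + 1) (reg s' (Work ''free'')) (?n + j) (aux_gate C j)"
      using old(4) by (rule placed_frame) (use d i j in auto)
    ultimately show ?thesis by blast
  qed
  with d free show ?thesis by (auto simp: nodes_inv_def Let_def)
qed

text \<open>In \<open>child\<close>, \<open>finish\<close> writes only to cell \<open>2 * n\<close>
  and to cells from \<open>f\<close> on, and elsewhere only to records from \<open>2 * n\<close> on.
  So all gates placed before stay intact.\<close>

lemma stores_finish: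
  assumes inv: "nodes_inv C S (length (gates C)) s"
  shows "stores_circuit Out (run finish s) (quantified C S)"
proof -
  define n where "n = length (gates C)"
  define f where "f = reg s (Work ''free'')"
  note I = inv[unfolded nodes_inv_def Let_def, folded n_def f_def]
  have f: "2 * n + 1 \<le> f" using I by simp
  let ?s = "run finish s"
  have inp: "reg s (In ''nodes'') = n" "reg s (In ''root'') = top_node C"
    using I by (auto simp: stores_circuit_def n_def)
  have regs: "reg ?s (Out ''nodes'') = 2 * n + 3" "reg ?s (Out ''root'') = 2 * n + 2"
    by (simp_all add: finish_def inp)
  have kind: "arr ?s (Out ''kind'') =
      (arr s (Out ''kind''))(2 * n := 0, Suc (2 * n) := 3, Suc (Suc (2 * n)) := 2)"
    by (simp add: finish_def inp mult_2)
  have fst: "arr ?s (Out ''fst'') =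
      (arr s (Out ''fst''))(2 * n := 1, Suc (2 * n) := 0, Suc (Suc (2 * n)) := f)"
    by (simp add: finish_def inp mult_2 f_def)
  have snd: "arr ?s (Out ''snd'') =
      (arr s (Out ''snd''))(Suc (2 * n) := Suc (2 * n), Suc (Suc (2 * n)) := 2)"
    by (simp add: finish_def inp mult_2)
  have child: "arr ?s (Out ''child'') =
      (arr s (Out ''child''))(2 * n := 2 * n, f := top_node C, Suc f := Suc (2 * n))"
    by (simp add: finish_def inp mult_2 f_def)
  have same: "arr ?s (Out a) j = arr s (Out a) j" if "a \<noteq> ''child''" "j < 2 * n" for a j
    using that by (auto simp: finish_def inp)
  have keep: "stores_gate Out ?s j g" if "placed s (2 * n + 1) f j g" "j < 2 * n" for j g
  proof -
    have "placed ?s (2 * n + 1) f j g"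
      using that(1) by (rule placed_frame) (use that(2) in \<open>auto simp: same child\<close>)
    then show ?thesis by (simp add: placed_def)
  qed
  \<comment> \<open>The last of these cells is written by \<open>finish\<close>, the others during
    the loop.\<close>
  have id: "arr ?s (Out ''child'') k = k" if "k < Suc (2 * n)" for k
  proof -
    have "k < n \<or> (\<exists>j<n. k = n + j) \<or> k = 2 * n"
      using that by (metis add_less_cancel_left le_Suc_ex less_Suc_eq linorder_not_less mult_2)
    then show ?thesis using I f by (auto simp: child)
  qed
  note nth = nth_quantified[where C = C and S = S, folded n_def]
  have "stores_gate Out ?s i (gates (quantified C S) ! i)" if "i < 2 * n + 3" for i
    using that
  proof (cases rule: less_quantified_cases)
    case 1
    then show ?thesis using I by (auto simp: nth intro: keep)
  next
    case (2 j)
    then show ?thesis using I by (auto simp: nth intro: keep)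
  next
    case 3
    then show ?thesis by (simp add: nth kind fst)
  next
    case 4
    then show ?thesis using id by (simp add: nth kind fst snd del: upt_Suc)
  next
    case 5
    then show ?thesis using f by (simp add: nth kind fst snd child All_less_Suc)
  qed
  then show ?thesis by (simp add: stores_circuit_def regs n_def)
qed

text \<open>The factor 3 covers at most \<open>2 * N\<close> literals and one more unit, the factor
  2 the tests of the loop over the nodes. The 15 absorbs the initial 2 and also exceeds the factor
  13 of the size bound.\<close>

definition time_const :: nat where
  "time_const = 15 + 3 * (tcost (Less ri (Reg (In ''lits''))) + run_cost mark_body) +
     run_cost nodes_init + 2 * tcost (Less ri rn) + node_cost + copy_cost + run_cost finish"

lemma halts_quantify:
  assumes C: "decision_dnnf C" and inp: "input_state C ls s"
    and N: "length ls \<le> 2 * N" "circuit_size C \<le> N"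
  shows "halts quantify s (time_const * N) (\<lambda>s'. stores_circuit Out s' (quantified C (set ls)))"
proof -
  let ?n = "length (gates C)" and ?S = "set ls" and ?E = "\<Sum>g\<leftarrow>gates C. length (children g)"
  let ?K = "tcost (Less ri (Reg (In ''lits''))) + run_cost mark_body" and ?B = "tcost (Less ri rn)"
  \<comment> \<open>The top node is a gate, so \<open>N\<close> is at least 1 and constant costs can
    be charged to it.\<close>
  have "0 < ?n" using C unfolding decision_dnnf_def nnf_circuit_def by linarith
  then have n: "1 \<le> N" "?n \<le> N" "?E \<le> N" using N(2) unfolding circuit_size_def by linarith+
  have E: "(\<Sum>k<?n. length (children (gates C ! k))) = ?E"
    by (simp add: sum_list_sum_nth lessThan_atLeast0)
  have loop: "halts (While (Less ri rn) node_body) s1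
      (?B * Suc ?n + (\<Sum>k<?n. node_cost + copy_cost * length (children (gates C ! k))))
      (nodes_inv C ?S ?n)" if "nodes_inv C ?S 0 s1" for s1
  proof (rule halts_While)
    fix k s' assume k: "k < ?n" and inv: "nodes_inv C ?S k s'"
    then have "stores_circuit In s' C" "marked s' ?S" "reg s' (Work ''i'') = k"
      "2 * ?n + 1 \<le> reg s' (Work ''free'')" by (auto simp: nodes_inv_def Let_def)
    note halts_node_body[OF C this(1,2) k this(3,4)]
    then have "halts node_body s' (node_cost + copy_cost * length (children (gates C ! k)))
      (nodes_inv C ?S (Suc k))"
      by (rule halts_mono) (use nodes_inv_step[OF inv k] in auto)
    moreover have "tval (Less ri rn) s'"
      using inv k by (auto simp: nodes_inv_def Let_def stores_circuit_def)
    ultimately show "tval (Less ri rn) s' \<and>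
      halts node_body s' (node_cost + copy_cost * length (children (gates C ! k))) (nodes_inv C ?S (Suc k))"
      by blast
  qed (use that in \<open>auto simp: nodes_inv_def Let_def stores_circuit_def\<close>)
  have "halts quantify s ((2 + ?K * (length ls + 1)) + (run_cost nodes_init +
    ((?B * Suc ?n + (\<Sum>k<?n. node_cost + copy_cost * length (children (gates C ! k)))) + run_cost finish)))
    (\<lambda>s'. stores_circuit Out s' (quantified C ?S))"
    unfolding quantify_def
  proof (rule halts_Seq[OF halts_mark_lits[of s C ls]])
    fix s1 assume s1: "stores_circuit In s1 C \<and> marked s1 ?S"
    have "nodes_inv C ?S 0 (run nodes_init s1)"
      using s1 by (simp add: nodes_init_def nodes_inv_def Let_def) (simp add: stores_circuit_def)
    from halts_run[where Q = "nodes_inv C ?S 0", OF loop_free_parts(6) this]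
    have init: "halts nodes_init s1 (run_cost nodes_init) (nodes_inv C ?S 0)" .
    show "halts (Seq nodes_init (Seq (While (Less ri rn) node_body) finish)) s1
      (run_cost nodes_init +
      ((?B * Suc ?n + (\<Sum>k<?n. node_cost + copy_cost * length (children (gates C ! k)))) + run_cost finish))
      (\<lambda>s'. stores_circuit Out s' (quantified C ?S))"
      by (intro halts_Seq[OF init] halts_Seq[OF loop] halts_run[OF loop_free_parts(7)] stores_finish)
  qed (use inp in \<open>simp_all add: input_state_def\<close>)
  moreover have "(2 + ?K * (length ls + 1)) + (run_cost nodes_init +
    ((?B * Suc ?n + (\<Sum>k<?n. node_cost + copy_cost * length (children (gates C ! k)))) + run_cost finish))
    \<le> time_const * N"
  proof -
    have "?K * (length ls + 1) \<le> ?K * (3 * N)" "?B * Suc ?n \<le> ?B * (2 * N)"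
      using N(1) n by (intro mult_le_mono2; simp)+
    moreover have "node_cost * ?n \<le> node_cost * N" "copy_cost * ?E \<le> copy_cost * N"
      "run_cost nodes_init \<le> run_cost nodes_init * N" "run_cost finish \<le> run_cost finish * N" "2 \<le> 15 * N"
      using n by simp_all
    moreover have "(\<Sum>k<?n. node_cost + copy_cost * length (children (gates C ! k))) =
      node_cost * ?n + copy_cost * ?E"
      by (simp only: sum.distrib sum_distrib_left[symmetric] E) simp
    moreover have "time_const * N = 15 * N + ?K * (3 * N) + run_cost nodes_init * N + ?B * (2 * N) +
      node_cost * N + copy_cost * N + run_cost finish * N"
      unfolding time_const_def by (simp only: algebra_simps)
    ultimately show ?thesis by linarith
  qed
  ultimately show ?thesis by (rule halts_mono)
qed

(* The literals are given as a list without repetitions.  The card term is 0 when all of them are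
   over variables of the circuit; otherwise it pays for reading the literals that are not.  The
   bound on the size of the output rules out a compact memory representation in which adjacency
   lists overlap. *)

theorem proposition25:
  shows "\<exists>(P :: com) (c :: nat). \<forall>(C :: circuit) (ls :: lit list) (s :: state).
     decision_dnnf C \<and> distinct ls \<and> input_state C ls s \<longrightarrow>
     (\<exists>t s' D. exec P s t s' \<and>
        t \<le> c * (circuit_size C + card {l \<in> set ls. lit_var l \<notin> circuit_vars C}) \<and>
        circuit_size D \<le> c * circuit_size C \<and>
        stores_circuit Out s' D \<and> nnf_circuit D \<and>
        equivalent (circuit_formula D) (forall_lits ls (circuit_formula C)))"
proof (rule exI[of _ quantify], rule exI[of _ time_const], intro allI impI)
  fix C ls s
  assume *: "decision_dnnf C \<and> distinct ls \<and> input_state C ls s"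
  let ?N = "circuit_size C + card {l \<in> set ls. lit_var l \<notin> circuit_vars C}"
  have "length ls \<le> 2 * ?N" using distinct_lits_bound[of ls C] * by simp
  with * have "halts quantify s (time_const * ?N) (\<lambda>s'. stores_circuit Out s' (quantified C (set ls)))"
    by (intro halts_quantify) auto
  then obtain t s' where "exec quantify s t s'" "t \<le> time_const * ?N"
    "stores_circuit Out s' (quantified C (set ls))" unfolding halts_def by blast
  \<comment> \<open>One constant has to serve for both the time and the size of the output.\<close>
  moreover have "13 \<le> time_const" by (simp add: time_const_def)
  then have "circuit_size (quantified C (set ls)) \<le> time_const * circuit_size C"
    using circuit_size_quantified[of C "set ls"] * mult_le_mono1 le_trans by blast
  ultimately show "\<exists>t s' D. exec quantify s t s' \<and> t \<le> time_const * ?N \<and>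
      circuit_size D \<le> time_const * circuit_size C \<and> stores_circuit Out s' D \<and> nnf_circuit D \<and>
      equivalent (circuit_formula D) (forall_lits ls (circuit_formula C))"
    using nnf_quantified equivalent_quantified * by blast
qed

end
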